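(* Let $M=S+K$ act on $L^2(-\pi,\pi)$, where $$Sf(x)=s(x)f(x),\qquad Kf(x)=\sum_{j=1}^l\langle f,g_j\rangle g_j(x),$$ $s$ is a bounded real-valued function and $g_1,\ldots,g_l\in L^2(-\pi,\pi)$. Let $\mathcal{L}_n=\mathrm{Span}\{e^{-inx},\ldots,e^{inx}\}$, let $\Pi_n$ be the orthogonal projection onto $\mathcal{L}_n$, and let $\lambda\in\mathrm{Spec}_{\mathrm{disc}}\,M$. Let $q\ge 1$. If $\frac{g_j(x)}{\lambda-s(x)}\in\mathcal{O}^q$ for all $j=1,\ldots,l$, then there is a sequence $\delta(n)>0$ with $\delta(n)=O(n^{-q+1/2})$ as $n\to\infty$ such that for all $\psi\in L^2(-\pi,\pi)$ with $M\psi=\lambda\psi$ and $\|\psi\|=1$, $$\|\Pi_nM^k\Pi_n\psi-\lambda^k\psi\|\le\delta(n)\qquad\text{for all } n\in\mathbb{N}\text{ and } k=0,1,2.$$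
   Context: $L^2(-\pi,\pi)$ carries the normalized inner product $\langle f,g\rangle=\frac{1}{2\pi}\int_{-\pi}^{\pi}f(x)\overline{g(x)}\,dx$. $\mathrm{Spec}_{\mathrm{disc}}\,M$ is the set of isolated eigenvalues of $M$ of finite multiplicity. For a function $h$, $\widehat h(n):=\langle h,e^{in(\cdot)}\rangle$ is its $n$th Fourier coefficient, and for $q\ge 1$, $\mathcal{O}^q$ is the set of $2\pi$-periodic functions $h$ on $\mathbb{R}$ such that $|\widehat h(n)|=O(|n|^{-q})$ as $n\to\pm\infty$; functions on $(-\pi,\pi)$ are identified with their $2\pi$-periodic extensions. *)

theory Defs
  imports "HOL-Analysis.Analysis" "HOL-Library.Landau_Symbols"
begin

text \<open>
  Elements of \<open>L\<^sup>2(-\<pi>, \<pi>)\<close> are represented by functions on the reals of which only the values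
  on \<open>(-\<pi>, \<pi>)\<close> matter; equality of elements is equality almost everywhere on \<open>(-\<pi>, \<pi>)\<close>.
\<close>

abbreviation I\<pi> :: "real measure" where
  "I\<pi> \<equiv> lebesgue_on {-pi<..<pi}"

definition L2 :: "(real \<Rightarrow> complex) set" where
  "L2 = {f. f \<in> borel_measurable I\<pi> \<and> integrable I\<pi> (\<lambda>x. (cmod (f x))\<^sup>2)}"

definition L2_eq :: "(real \<Rightarrow> complex) \<Rightarrow> (real \<Rightarrow> complex) \<Rightarrow> bool"  (infix \<open>\<doteq>\<close> 50) where
  "f \<doteq> g \<longleftrightarrow> (AE x in I\<pi>. f x = g x)"

definition L2_inner :: "(real \<Rightarrow> complex) \<Rightarrow> (real \<Rightarrow> complex) \<Rightarrow> complex" where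
  "L2_inner f g = complex_of_real (1 / (2 * pi)) * integral\<^sup>L I\<pi> (\<lambda>x. f x * cnj (g x))"

definition L2_norm :: "(real \<Rightarrow> complex) \<Rightarrow> real" where
  "L2_norm f = sqrt (Re (L2_inner f f))"

type_synonym L2_op = "(real \<Rightarrow> complex) \<Rightarrow> (real \<Rightarrow> complex)"

text \<open>Linearity and boundedness together imply that the operator respects \<open>\<doteq>\<close>.\<close>

definition L2_bounded_linear :: "L2_op \<Rightarrow> bool" where
  "L2_bounded_linear T \<longleftrightarrow>
     (\<forall>f\<in>L2. T f \<in> L2) \<and>
     (\<forall>f\<in>L2. \<forall>g\<in>L2. T (\<lambda>x. f x + g x) \<doteq> (\<lambda>x. T f x + T g x)) \<and>
     (\<forall>c. \<forall>f\<in>L2. T (\<lambda>x. c * f x) \<doteq> (\<lambda>x. c * T f x)) \<and>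
     (\<exists>C. \<forall>f\<in>L2. L2_norm (T f) \<le> C * L2_norm f)"

definition resolvent_set :: "L2_op \<Rightarrow> complex set" where
  "resolvent_set T = {z. \<exists>R. L2_bounded_linear R \<and>
     (\<forall>f\<in>L2. R (\<lambda>x. T f x - z * f x) \<doteq> f) \<and>
     (\<forall>f\<in>L2. (\<lambda>x. T (R f) x - z * R f x) \<doteq> f)}"

definition Spec :: "L2_op \<Rightarrow> complex set" where
  "Spec T = - resolvent_set T"

definition eigenspace :: "L2_op \<Rightarrow> complex \<Rightarrow> (real \<Rightarrow> complex) set" where
  "eigenspace T z = {f \<in> L2. T f \<doteq> (\<lambda>x. z * f x)}"

definition is_eigenvalue :: "L2_op \<Rightarrow> complex \<Rightarrow> bool" where
  "is_eigenvalue T z \<longleftrightarrow> (\<exists>f\<in>eigenspace T z. \<not> f \<doteq> (\<lambda>x. 0))"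

text \<open>Geometric multiplicity; for self-adjoint operators it coincides with the algebraic one.\<close>

definition finite_multiplicity :: "L2_op \<Rightarrow> complex \<Rightarrow> bool" where
  "finite_multiplicity T z \<longleftrightarrow>
     (\<exists>B. finite B \<and> B \<subseteq> eigenspace T z \<and>
        (\<forall>f\<in>eigenspace T z. \<exists>c. f \<doteq> (\<lambda>x. \<Sum>b\<in>B. c b * b x)))"

definition Spec_disc :: "L2_op \<Rightarrow> complex set" where
  "Spec_disc T = {z. is_eigenvalue T z \<and> z isolated_in Spec T \<and> finite_multiplicity T z}"

definition op_S :: "(real \<Rightarrow> real) \<Rightarrow> L2_op" where
  "op_S s f = (\<lambda>x. complex_of_real (s x) * f x)"

definition op_K :: "nat \<Rightarrow> (nat \<Rightarrow> real \<Rightarrow> complex) \<Rightarrow> L2_op" where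
  "op_K l g f = (\<lambda>x. \<Sum>j=1..l. L2_inner f (g j) * g j x)"

definition op_M :: "(real \<Rightarrow> real) \<Rightarrow> nat \<Rightarrow> (nat \<Rightarrow> real \<Rightarrow> complex) \<Rightarrow> L2_op" where
  "op_M s l g f = (\<lambda>x. op_S s f x + op_K l g f x)"

definition fourier_mode :: "int \<Rightarrow> real \<Rightarrow> complex" where
  "fourier_mode n x = exp (\<i> * complex_of_real (of_int n * x))"

definition trig_span :: "nat \<Rightarrow> (real \<Rightarrow> complex) set" where
  "trig_span n = {f. \<exists>c. f = (\<lambda>x. \<Sum>k\<in>{- int n..int n}. c k * fourier_mode k x)}"

text \<open>
  For a general subspace the projection is determined only up to \<open>\<doteq>\<close>; \<open>SOME\<close> picks a
  representative.
\<close>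

definition orth_proj :: "(real \<Rightarrow> complex) set \<Rightarrow> L2_op" where
  "orth_proj V f = (SOME p. p \<in> V \<and> (\<forall>v\<in>V. L2_inner (\<lambda>x. f x - p x) v = 0))"

definition \<Pi>proj :: "nat \<Rightarrow> L2_op" where
  "\<Pi>proj n = orth_proj (trig_span n)"

definition fourier_coeff :: "(real \<Rightarrow> complex) \<Rightarrow> int \<Rightarrow> complex" where
  "fourier_coeff h n = L2_inner h (fourier_mode n)"

text \<open>
  Integrability is required so that the Fourier coefficients are genuine: the integral of a
  non-integrable function is \<open>0\<close> by convention.
\<close>

definition \<O>_class :: "real \<Rightarrow> (real \<Rightarrow> complex) set" where
  "\<O>_class q = {h. (\<forall>x. h (x + 2 * pi) = h x) \<and> integrable I\<pi> h \<and>
     (\<lambda>n. cmod (fourier_coeff h n)) \<in> O[at_top](\<lambda>n. \<bar>real_of_int n\<bar> powr (- q)) \<and>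
     (\<lambda>n. cmod (fourier_coeff h n)) \<in> O[at_bot](\<lambda>n. \<bar>real_of_int n\<bar> powr (- q))}"

text \<open>
  The argument is shifted into \<open>[-\<pi>, \<pi>)\<close>; the value at odd multiples of \<open>\<pi>\<close> is immaterial.
\<close>

definition periodic_ext :: "(real \<Rightarrow> complex) \<Rightarrow> real \<Rightarrow> complex" where
  "periodic_ext f x = f (x - 2 * pi * of_int \<lfloor>(x + pi) / (2 * pi)\<rfloor>)"

end

theory Submission
  imports Defs "HOL-Computational_Algebra.Polynomial"
begin

text \<open>
  An eigenfunction \<open>\<psi>\<close> satisfies \<open>(lam - s) \<psi> = \<Sum>j. \<langle>\<psi>, g\<^sub>j\<rangle> g\<^sub>j\<close>. If \<open>lam \<noteq> s\<close> almost everywhere, one may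
  divide, so \<open>\<psi>\<close> is a combination of the functions \<open>g\<^sub>j / (lam - s)\<close> with coefficients which, by
  Cauchy--Schwarz, are at most \<open>\<parallel>g\<^sub>j\<parallel>\<close> in modulus. The decay of the Fourier coefficients of
  \<open>g\<^sub>j / (lam - s)\<close> thus passes to \<open>\<psi>\<close>, with a constant that does not depend on \<open>\<psi>\<close>
  (\<open>eigenfunction_fourier_coeff\<close>). By Parseval, \<open>\<parallel>\<psi> - \<Pi>\<^sub>n \<psi>\<parallel>\<^sup>2\<close> is the sum of
  \<open>|fourier_coeff \<psi> k|\<^sup>2 = O(|k| powr (-2q))\<close> over \<open>|k| > n\<close>, which is \<open>O(n powr (1 - 2q))\<close>
  (\<open>\<Pi>proj_error_of_fourier_decay\<close>). Finally
  \<open>\<Pi>\<^sub>n M\<^sup>k \<Pi>\<^sub>n \<psi> - lam\<^sup>k \<psi> = \<Pi>\<^sub>n M\<^sup>k d + lam\<^sup>k d\<close> with \<open>d = \<Pi>\<^sub>n \<psi> - \<psi>\<close>, because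
  \<open>M\<^sup>k \<psi> = lam\<^sup>k \<psi>\<close>; as \<open>M\<close> is bounded and \<open>\<Pi>\<^sub>n\<close> is a contraction, the error is at most a
  constant times \<open>\<parallel>d\<parallel>\<close> (\<open>compression_error\<close>).

  That \<open>lam \<noteq> s\<close> almost everywhere is what the finite multiplicity of \<open>lam\<close> provides
  (\<open>finite_multiplicity_imp_AE_ne\<close>): every function that lives on \<open>{s = lam}\<close> and is orthogonal to
  all \<open>g\<^sub>j\<close> is an eigenfunction, and if \<open>{s = lam}\<close> had positive measure, there would be infinitely
  many linearly independent ones.

  Parseval rests on the density of the trigonometric polynomials in \<open>L\<^sup>2\<close>
  (\<open>trig_polys_L2_dense\<close>). This follows from three approximations: of \<open>L\<^sup>2\<close> functions by bounded
  ones, of bounded functions by continuous ones vanishing at the endpoints, and of these, regarded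
  as functions on the unit circle, by polynomials in the coordinates of the plane
  (Stone--Weierstrass).
\<close>

section \<open>The semi-inner product space of square-integrable functions\<close>

lemma finite_measure_I: "finite_measure I\<pi>"
  by (rule finite_measure_lebesgue_on) (auto intro: lmeasurable_interval)

lemma measure_I: "measure I\<pi> (space I\<pi>) = 2 * pi"
  by (simp add: measure_restrict_space)

lemma integrable_const_I: "integrable I\<pi> (\<lambda>x. c :: 'b :: {banach, second_countable_topology})"
  by (rule finite_measure.integrable_const[OF finite_measure_I])

lemma L2_measurable: "f \<in> L2 \<Longrightarrow> f \<in> borel_measurable I\<pi>"
  by (simp add: L2_def)

lemma L2_integrable_mult_cnj:
  assumes "f \<in> L2" "g \<in> L2"
  shows "integrable I\<pi> (\<lambda>x. f x * cnj (g x))"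
proof (rule Bochner_Integration.integrable_bound)
  show "integrable I\<pi> (\<lambda>x. (cmod (f x))\<^sup>2 + (cmod (g x))\<^sup>2)"
    using assms by (auto simp: L2_def)
  show "(\<lambda>x. f x * cnj (g x)) \<in> borel_measurable I\<pi>"
    using assms
    by (auto simp: L2_def intro!: borel_measurable_times measurable_compose[of g _ borel cnj]
        borel_measurable_continuous_onI continuous_intros)
  have "a * b \<le> a\<^sup>2 + b\<^sup>2" if "a \<ge> 0" "b \<ge> 0" for a b :: real
    using sum_squares_bound[of a b] mult_nonneg_nonneg[OF that] by linarith
  thus "AE x in I\<pi>. norm (f x * cnj (g x)) \<le> norm ((cmod (f x))\<^sup>2 + (cmod (g x))\<^sup>2)"
    by (auto simp: norm_mult)
qed

lemma L2_const_I [simp]: "(\<lambda>x. c) \<in> L2"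
  by (auto simp: L2_def integrable_const_I)

lemma L2_add [intro]:
  assumes "f \<in> L2" "g \<in> L2"
  shows "(\<lambda>x. f x + g x) \<in> L2"
proof -
  have "integrable I\<pi> (\<lambda>x. (cmod (f x + g x))\<^sup>2)"
  proof (rule Bochner_Integration.integrable_bound)
    show "integrable I\<pi> (\<lambda>x. 2 * (cmod (f x))\<^sup>2 + 2 * (cmod (g x))\<^sup>2)"
      using assms by (auto simp: L2_def)
    show "(\<lambda>x. (cmod (f x + g x))\<^sup>2) \<in> borel_measurable I\<pi>"
      using assms by (auto simp: L2_def)
    have "(cmod (a + b))\<^sup>2 \<le> 2 * (cmod a)\<^sup>2 + 2 * (cmod b)\<^sup>2" for a b :: complex
    proof -
      have "(cmod (a + b))\<^sup>2 \<le> (cmod a + cmod b)\<^sup>2"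
        by (simp add: norm_triangle_ineq power_mono)
      also have "\<dots> \<le> 2 * (cmod a)\<^sup>2 + 2 * (cmod b)\<^sup>2"
        using sum_squares_bound[of "cmod a" "cmod b"] by (simp add: power2_sum)
      finally show ?thesis .
    qed
    thus "AE x in I\<pi>. norm ((cmod (f x + g x))\<^sup>2) \<le> norm (2 * (cmod (f x))\<^sup>2 + 2 * (cmod (g x))\<^sup>2)"
      by auto
  qed
  thus ?thesis using assms by (auto simp: L2_def)
qed

lemma L2_cmult [intro]: "f \<in> L2 \<Longrightarrow> (\<lambda>x. c * f x) \<in> L2"
  by (auto simp: L2_def norm_mult power_mult_distrib)

lemma L2_diff [intro]: "f \<in> L2 \<Longrightarrow> g \<in> L2 \<Longrightarrow> (\<lambda>x. f x - g x) \<in> L2"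
  using L2_add[OF _ L2_cmult[of g "-1"], of f] by simp

lemma L2_sum [intro]: "(\<And>i. i \<in> A \<Longrightarrow> f i \<in> L2) \<Longrightarrow> (\<lambda>x. \<Sum>i\<in>A. f i x) \<in> L2"
  by (induction A rule: infinite_finite_induct) auto

lemma L2_bounded_measurable:
  assumes "f \<in> borel_measurable I\<pi>" "\<And>x. x \<in> {-pi<..<pi} \<Longrightarrow> cmod (f x) \<le> C"
  shows "f \<in> L2"
proof -
  have "integrable I\<pi> (\<lambda>x. (cmod (f x))\<^sup>2)"
  proof (rule Bochner_Integration.integrable_bound[OF integrable_const_I[of "C\<^sup>2"]])
    show "AE x in I\<pi>. norm ((cmod (f x))\<^sup>2) \<le> norm (C\<^sup>2)"
      using assms(2) by (auto intro!: AE_I2 power_mono)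
  qed (use assms in auto)
  thus ?thesis using assms by (auto simp: L2_def)
qed

lemma L2_inner_add_left:
  "\<lbrakk>f \<in> L2; g \<in> L2; h \<in> L2\<rbrakk> \<Longrightarrow> L2_inner (\<lambda>x. f x + g x) h = L2_inner f h + L2_inner g h"
  by (simp add: L2_inner_def ring_distribs Bochner_Integration.integral_add L2_integrable_mult_cnj)

lemma L2_inner_cmult_left: "L2_inner (\<lambda>x. c * f x) h = c * L2_inner f h"
  by (simp add: L2_inner_def mult.assoc)

lemma L2_inner_diff_left:
  "\<lbrakk>f \<in> L2; g \<in> L2; h \<in> L2\<rbrakk> \<Longrightarrow> L2_inner (\<lambda>x. f x - g x) h = L2_inner f h - L2_inner g h"
  by (simp add: L2_inner_def ring_distribs Bochner_Integration.integral_diff L2_integrable_mult_cnj)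

lemma L2_inner_sum_left:
  "\<lbrakk>\<And>i. i \<in> A \<Longrightarrow> f i \<in> L2; h \<in> L2\<rbrakk> \<Longrightarrow>
    L2_inner (\<lambda>x. \<Sum>i\<in>A. f i x) h = (\<Sum>i\<in>A. L2_inner (f i) h)"
  by (simp add: L2_inner_def sum_distrib_right sum_distrib_left Bochner_Integration.integral_sum L2_integrable_mult_cnj)

lemma L2_inner_cnj: "cnj (L2_inner f g) = L2_inner g f"
proof -
  have "cnj (LINT x|I\<pi>. f x * cnj (g x)) = (LINT x|I\<pi>. cnj (f x * cnj (g x)))"
    by (rule Bochner_Integration.integral_cnj[symmetric])
  also have "\<dots> = (LINT x|I\<pi>. g x * cnj (f x))"
    by (simp add: mult.commute)
  finally show ?thesis by (simp add: L2_inner_def)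
qed

lemma L2_inner_self: "L2_inner f f = complex_of_real (1 / (2 * pi) * (LINT x|I\<pi>. (cmod (f x))\<^sup>2))"
proof -
  have "L2_inner f f = complex_of_real (1 / (2 * pi)) * (LINT x|I\<pi>. complex_of_real ((cmod (f x))\<^sup>2))"
    by (simp add: L2_inner_def complex_norm_square flip: of_real_power)
  thus ?thesis by (simp only: integral_complex_of_real of_real_mult)
qed

lemma L2_norm_sq: "(L2_norm f)\<^sup>2 = 1 / (2 * pi) * (LINT x|I\<pi>. (cmod (f x))\<^sup>2)"
  by (simp add: L2_norm_def L2_inner_self)

lemma L2_norm_nonneg [simp]: "L2_norm f \<ge> 0"
  by (simp add: L2_norm_def L2_inner_self)

lemma L2_inner_self_norm: "L2_inner f f = complex_of_real ((L2_norm f)\<^sup>2)"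
  by (simp add: L2_norm_sq L2_inner_self)

lemma L2_norm_cmult: "L2_norm (\<lambda>x. c * f x) = cmod c * L2_norm f"
proof -
  have "(L2_norm (\<lambda>x. c * f x))\<^sup>2 = (cmod c * L2_norm f)\<^sup>2"
    by (simp add: L2_norm_sq norm_mult power_mult_distrib)
  thus ?thesis by (simp add: power2_eq_iff_nonneg)
qed

lemma L2_norm_minus_commute: "L2_norm (\<lambda>x. f x - g x) = L2_norm (\<lambda>x. g x - f x)"
  using L2_norm_cmult[of "-1" "\<lambda>x. f x - g x"] by simp

lemma L2_inner_cong_left:
  assumes "f \<doteq> g" "f \<in> L2" "g \<in> L2" "h \<in> L2"
  shows "L2_inner f h = L2_inner g h"
proof -
  have "(LINT x|I\<pi>. f x * cnj (h x)) = (LINT x|I\<pi>. g x * cnj (h x))"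
    using assms L2_integrable_mult_cnj[of f h] L2_integrable_mult_cnj[of g h]
    by (intro integral_cong_AE) (auto simp: L2_eq_def)
  thus ?thesis by (simp add: L2_inner_def)
qed

lemma L2_norm_eq_0:
  assumes "f \<in> L2" "L2_norm f = 0"
  shows "f \<doteq> (\<lambda>x. 0)"
proof -
  have "(LINT x|I\<pi>. (cmod (f x))\<^sup>2) = 0"
    using L2_norm_sq[of f] assms(2) by simp
  thus ?thesis
    using assms(1) by (subst (asm) integral_nonneg_eq_0_iff_AE) (auto simp: L2_def L2_eq_def)
qed

lemma L2_norm_sq_add:
  assumes "f \<in> L2" "g \<in> L2"
  shows "(L2_norm (\<lambda>x. f x + g x))\<^sup>2 = (L2_norm f)\<^sup>2 + (L2_norm g)\<^sup>2 + 2 * Re (L2_inner f g)"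
proof -
  have right: "L2_inner h (\<lambda>x. f x + g x) = L2_inner h f + L2_inner h g" if "h \<in> L2" for h
    using L2_inner_add_left[OF assms that] by (metis L2_inner_cnj complex_cnj_add)
  have "complex_of_real ((L2_norm (\<lambda>x. f x + g x))\<^sup>2) =
      L2_inner f f + L2_inner g g + (L2_inner f g + cnj (L2_inner f g))"
    unfolding L2_inner_self_norm[symmetric]
    using assms by (subst L2_inner_add_left) (auto simp: right L2_inner_cnj)
  also have "\<dots> = complex_of_real ((L2_norm f)\<^sup>2 + (L2_norm g)\<^sup>2 + 2 * Re (L2_inner f g))"
    by (simp add: L2_inner_self_norm complex_add_cnj)
  finally show ?thesis using of_real_eq_iff by blast
qed

lemma L2_Cauchy_Schwarz:
  assumes "f \<in> L2" "g \<in> L2"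
  shows "cmod (L2_inner f g) \<le> L2_norm f * L2_norm g"
proof -
  define z where "z = L2_inner f g"
  (* Expanding the norm of c f + g, where the phase of c turns the mixed term into -2 t |<f,g>|. *)
  have quad: "0 \<le> (L2_norm f)\<^sup>2 * t\<^sup>2 + (L2_norm g)\<^sup>2 - 2 * t * cmod z" for t :: real
  proof -
    define c where "c = - complex_of_real t * cnj (sgn z)"
    have "0 \<le> (L2_norm (\<lambda>x. c * f x + g x))\<^sup>2" by simp
    also have "\<dots> = (cmod c * L2_norm f)\<^sup>2 + (L2_norm g)\<^sup>2 + 2 * Re (c * z)"
      using assms by (subst L2_norm_sq_add) (auto simp: L2_norm_cmult L2_inner_cmult_left z_def)
    also have "(cmod c * L2_norm f)\<^sup>2 \<le> (L2_norm f)\<^sup>2 * t\<^sup>2"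
      by (auto simp: c_def norm_mult norm_sgn power_mult_distrib)
    also have "c * z = complex_of_real (- t * cmod z)"
    proof -
      have "cnj (sgn z) * z = complex_of_real (cmod z)"
      proof (cases "z = 0")
        case False
        have "z * cnj z = complex_of_real (cmod z) * complex_of_real (cmod z)"
          by (metis complex_norm_square power2_eq_square of_real_power)
        thus ?thesis using False by (simp add: sgn_eq field_simps)
      qed auto
      thus ?thesis by (simp add: c_def mult.assoc)
    qed
    finally show ?thesis by simp
  qed
  have "cmod z \<le> L2_norm f * L2_norm g"
  proof (cases "L2_norm f = 0")
    case True
    have "cmod z = 0"
    proof (rule ccontr)
      assume "cmod z \<noteq> 0"
      (* the quadratic has degenerated to an affine function of t, which takes negative values *)
      thus False using quad[of "((L2_norm g)\<^sup>2 + 1) / (2 * cmod z)"] True by (simp add: field_simps)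
    qed
    thus ?thesis using True by simp
  next
    case False
    define a b where "a = L2_norm f" and "b = L2_norm g"
    have a: "a > 0" using False by (metis a_def L2_norm_nonneg less_le)
    have b: "b \<ge> 0" by (simp add: b_def)
    (* cmod z / a^2 is the minimum point of the quadratic. *)
    have "0 \<le> a\<^sup>2 * (cmod z / a\<^sup>2)\<^sup>2 + b\<^sup>2 - 2 * (cmod z / a\<^sup>2) * cmod z"
      using quad[of "cmod z / a\<^sup>2"] by (simp add: a_def b_def)
    also have "\<dots> = b\<^sup>2 - (cmod z)\<^sup>2 / a\<^sup>2"
      using a by (simp add: field_simps power2_eq_square)
    finally have "(cmod z)\<^sup>2 \<le> (a * b)\<^sup>2" using a by (simp add: field_simps power_mult_distrib)
    thus ?thesis using a b by (simp add: a_def b_def power2_le_iff_abs_le)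
  qed
  thus ?thesis by (simp add: z_def)
qed

lemma L2_norm_triangle:
  assumes "f \<in> L2" "g \<in> L2"
  shows "L2_norm (\<lambda>x. f x + g x) \<le> L2_norm f + L2_norm g"
proof (rule power2_le_imp_le)
  have "Re (L2_inner f g) \<le> L2_norm f * L2_norm g"
    using L2_Cauchy_Schwarz[OF assms] complex_Re_le_cmod order_trans by blast
  thus "(L2_norm (\<lambda>x. f x + g x))\<^sup>2 \<le> (L2_norm f + L2_norm g)\<^sup>2"
    using assms by (simp add: L2_norm_sq_add power2_sum)
qed auto

lemma L2_norm_sum:
  "finite A \<Longrightarrow> (\<And>i. i \<in> A \<Longrightarrow> f i \<in> L2) \<Longrightarrow> L2_norm (\<lambda>x. \<Sum>i\<in>A. f i x) \<le> (\<Sum>i\<in>A. L2_norm (f i))"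
proof (induction A rule: finite_induct)
  case empty
  show ?case by (simp add: L2_norm_def L2_inner_def)
next
  case (insert a A)
  thus ?case using L2_norm_triangle[of "f a" "\<lambda>x. \<Sum>i\<in>A. f i x"] by fastforce
qed

lemma L2_norm_bound:
  assumes "f \<in> borel_measurable I\<pi>" "\<And>x. x \<in> {-pi<..<pi} \<Longrightarrow> cmod (f x) \<le> C" 
  shows "L2_norm f \<le> C"
proof (rule power2_le_imp_le)
  show C: "C \<ge> 0" using assms(2)[of 0] by (auto intro: order_trans[OF norm_ge_zero])
  have "(LINT x|I\<pi>. (cmod (f x))\<^sup>2) \<le> (LINT x|I\<pi>. C\<^sup>2)"
    using L2_bounded_measurable[OF assms] assms(2)
    by (intro integral_mono) (auto simp: L2_def integrable_const_I intro!: power_mono)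
  also have "\<dots> = 2 * pi * C\<^sup>2"
    by (simp add: measure_I[simplified])
  finally show "(L2_norm f)\<^sup>2 \<le> C\<^sup>2"
    by (simp add: L2_norm_sq field_simps)
qed

text \<open>
  Dominated convergence for the norm; both truncation and regularisation below are instances.
\<close>

lemma L2_norm_tendsto_0:
  assumes f: "f \<in> borel_measurable I\<pi>" and u: "\<And>n. u n \<in> borel_measurable I\<pi>"
    and lim: "AE x in I\<pi>. (\<lambda>n. u n x) \<longlonglongrightarrow> f x"
    and w: "integrable I\<pi> w" "\<And>n. AE x in I\<pi>. (cmod (f x - u n x))\<^sup>2 \<le> w x"
  shows "(\<lambda>n. L2_norm (\<lambda>x. f x - u n x)) \<longlonglongrightarrow> 0"
proof -
  have "(\<lambda>n. LINT x|I\<pi>. (cmod (f x - u n x))\<^sup>2) \<longlonglongrightarrow> (LINT x|I\<pi>. 0)"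
  proof (rule integral_dominated_convergence[where w = w])
    show "AE x in I\<pi>. (\<lambda>n. (cmod (f x - u n x))\<^sup>2) \<longlonglongrightarrow> 0"
      using lim
    proof eventually_elim
      case (elim x)
      have "(\<lambda>n. (cmod (f x - u n x))\<^sup>2) \<longlonglongrightarrow> (cmod (f x - f x))\<^sup>2"
        by (intro tendsto_intros elim)
      thus ?case by simp
    qed
  qed (use f u w in auto)
  hence "(\<lambda>n. sqrt (1 / (2 * pi) * (LINT x|I\<pi>. (cmod (f x - u n x))\<^sup>2))) \<longlonglongrightarrow> sqrt (1 / (2 * pi) * 0)"
    by (intro tendsto_intros) simp
  thus ?thesis by (simp add: L2_norm_def L2_inner_self)
qed

section \<open>Fourier modes and orthogonal projections\<close>

lemma fourier_mode_add: "fourier_mode (j + k) x = fourier_mode j x * fourier_mode k x"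
  by (simp add: fourier_mode_def ring_distribs flip: exp_add)

lemma cnj_fourier_mode: "cnj (fourier_mode k x) = fourier_mode (- k) x"
  by (simp add: fourier_mode_def exp_cnj)

lemma cmod_fourier_mode [simp]: "cmod (fourier_mode k x) = 1"
  using norm_exp_i_times[of "of_int k * x"] by (simp add: fourier_mode_def)

lemma fourier_mode_0 [simp]: "fourier_mode 0 x = 1"
  by (simp add: fourier_mode_def)

lemma continuous_imp_measurable_I:
  "continuous_on {-pi<..<pi} f \<Longrightarrow> f \<in> borel_measurable I\<pi>" for f :: "real \<Rightarrow> complex"
  by (rule continuous_imp_measurable_on_sets_lebesgue) auto

lemma continuous_on_fourier_mode [continuous_intros]: "continuous_on S (fourier_mode k)"
  unfolding fourier_mode_def by (intro continuous_intros)

lemma fourier_mode_measurable: "fourier_mode k \<in> borel_measurable I\<pi>"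
  by (intro continuous_imp_measurable_I continuous_intros)

lemma fourier_mode_L2 [simp, intro]: "fourier_mode k \<in> L2"
  by (rule L2_bounded_measurable[where C = 1]) (auto simp: fourier_mode_measurable)

lemma integral_fourier_mode:
  "(LINT x|I\<pi>. fourier_mode m x) = (if m = 0 then 2 * pi else 0)"
proof (cases "m = 0")
  case True
  thus ?thesis by (simp add: measure_I[simplified] scaleR_conv_of_real)
next
  case False
  have "((\<lambda>x. exp (\<i> * of_int m * of_real x)) has_integral
      exp (\<i> * of_int m * of_real pi) / (\<i> * of_int m) - exp (\<i> * of_int m * of_real (-pi)) / (\<i> * of_int m)) {-pi..pi}"
  proof (rule fundamental_theorem_of_calculus)
    show "((\<lambda>x. exp (\<i> * of_int m * of_real x) / (\<i> * of_int m)) has_vector_derivative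
        exp (\<i> * of_int m * of_real x)) (at x within {-pi..pi})" for x
    proof (rule has_vector_derivative_real_field)
      show "((\<lambda>z. exp (\<i> * of_int m * z) / (\<i> * of_int m)) has_field_derivative
          exp (\<i> * of_int m * of_real x)) (at (of_real x))"
        by (rule derivative_eq_intros refl | use False in force)+
    qed
  qed simp
  moreover have "exp (\<i> * of_int m * of_real pi) = exp (\<i> * of_int m * of_real (-pi))"
    unfolding exp_eq by (rule exI[of _ m]) (simp add: algebra_simps)
  ultimately have "(fourier_mode m has_integral 0) {-pi<..<pi}"
    by (simp add: fourier_mode_def[abs_def] mult.assoc has_integral_Icc_iff_Ioo)
  moreover have "integrable I\<pi> (fourier_mode m)"
    using L2_integrable_mult_cnj[of "fourier_mode m" "fourier_mode 0"] by simp
  hence "(fourier_mode m has_integral (LINT x|I\<pi>. fourier_mode m x)) {-pi<..<pi}"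
    by (rule has_integral_integral_lebesgue_on) simp
  ultimately show ?thesis using False by (auto dest: has_integral_unique)
qed

lemma fourier_mode_orthonormal:
  "L2_inner (fourier_mode j) (fourier_mode k) = (if j = k then 1 else 0)"
proof -
  have "L2_inner (fourier_mode j) (fourier_mode k) =
      complex_of_real (1 / (2 * pi)) * (LINT x|I\<pi>. fourier_mode (j - k) x)"
    by (simp add: L2_inner_def cnj_fourier_mode flip: fourier_mode_add)
  thus ?thesis by (simp add: integral_fourier_mode)
qed

definition trig_poly :: "int set \<Rightarrow> (int \<Rightarrow> complex) \<Rightarrow> real \<Rightarrow> complex" where
  "trig_poly A c x = (\<Sum>k\<in>A. c k * fourier_mode k x)"

lemma trig_poly_L2 [simp, intro]: "trig_poly A c \<in> L2"
  unfolding trig_poly_def[abs_def] by (intro L2_sum L2_cmult fourier_mode_L2)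

lemma trig_span_eq: "trig_span n = range (trig_poly {- int n..int n})"
  by (auto simp: trig_span_def trig_poly_def fun_eq_iff image_iff)

lemma fourier_coeff_trig_poly:
  assumes "finite A"
  shows "fourier_coeff (trig_poly A c) j = (if j \<in> A then c j else 0)"
  unfolding fourier_coeff_def trig_poly_def[abs_def] using assms
  by (subst L2_inner_sum_left) 
     (auto simp: L2_inner_cmult_left fourier_mode_orthonormal if_distrib[of "(*) _"] cong: if_cong)

lemma L2_inner_trig_poly_right:
  assumes "finite A" "f \<in> L2"
  shows "L2_inner f (trig_poly A c) = (\<Sum>k\<in>A. cnj (c k) * fourier_coeff f k)"
proof -
  have "L2_inner f (trig_poly A c) = cnj (L2_inner (trig_poly A c) f)"
    by (simp add: L2_inner_cnj)
  also have "L2_inner (trig_poly A c) f = (\<Sum>k\<in>A. c k * L2_inner (fourier_mode k) f)"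
    unfolding trig_poly_def[abs_def] using assms 
    by (subst L2_inner_sum_left) (auto simp: L2_inner_cmult_left)
  finally show ?thesis by (simp add: L2_inner_cnj fourier_coeff_def)
qed

lemma L2_norm_trig_poly:
  assumes "finite A"
  shows "(L2_norm (trig_poly A c))\<^sup>2 = (\<Sum>k\<in>A. (cmod (c k))\<^sup>2)"
proof -
  have "complex_of_real ((L2_norm (trig_poly A c))\<^sup>2) = (\<Sum>k\<in>A. c k * cnj (c k))"
    using assms unfolding L2_inner_self_norm[symmetric]
    by (subst L2_inner_trig_poly_right) (auto simp: fourier_coeff_trig_poly mult.commute)
  also have "\<dots> = complex_of_real (\<Sum>k\<in>A. (cmod (c k))\<^sup>2)"
    by (simp only: complex_norm_square of_real_sum)
  finally show ?thesis using of_real_eq_iff by blast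
qed

text \<open>
  The residual of the Fourier sum is orthogonal to all modes in \<open>A\<close>, so Pythagoras applies. Taking
  \<open>d = 0\<close> gives Bessel's inequality, a general \<open>d\<close> shows that the Fourier sum is the best
  approximation, and a \<open>d\<close> that agrees with the Fourier coefficients on a part of \<open>A\<close> and is zero
  elsewhere compares two Fourier sums.
\<close>

lemma L2_norm_sq_diff_trig_poly:
  assumes "finite A" "f \<in> L2"
  shows "(L2_norm (\<lambda>x. f x - trig_poly A d x))\<^sup>2 =
    (L2_norm (\<lambda>x. f x - trig_poly A (fourier_coeff f) x))\<^sup>2 + (\<Sum>k\<in>A. (cmod (fourier_coeff f k - d k))\<^sup>2)"
proof -
  define r where "r = (\<lambda>x. f x - trig_poly A (fourier_coeff f) x)"
  define w where "w = trig_poly A (\<lambda>k. fourier_coeff f k - d k)"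
  have r: "r \<in> L2" using assms unfolding r_def by (intro L2_diff) auto
  have "fourier_coeff r k = 0" if "k \<in> A" for k
    using fourier_coeff_trig_poly[OF assms(1), of "fourier_coeff f" k] assms(2) that
    unfolding r_def fourier_coeff_def by (subst L2_inner_diff_left) auto
  hence "L2_inner r w = 0"
    using assms(1) r by (simp add: w_def L2_inner_trig_poly_right)
  moreover have "(\<lambda>x. f x - trig_poly A d x) = (\<lambda>x. r x + w x)"
    by (auto simp: r_def w_def trig_poly_def ring_distribs sum_subtractf)
  ultimately show ?thesis
    using L2_norm_sq_add[OF r, of w] L2_norm_trig_poly[OF assms(1)] by (simp add: w_def r_def)
qed

text \<open>
  Orthogonality to every mode in the span determines the coefficients of the projection. Hence
  there is no ambiguity in the choice made by \<open>orth_proj\<close>: the equation holds pointwise, not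
  just almost everywhere.
\<close>

lemma \<Pi>proj_eq:
  assumes "f \<in> L2"
  shows "\<Pi>proj n f = trig_poly {- int n..int n} (fourier_coeff f)"
proof -
  define A where "A = {- int n..int n}"
  have A: "finite A" by (simp add: A_def)
  define P where "P = (\<lambda>p. p \<in> trig_span n \<and> (\<forall>v\<in>trig_span n. L2_inner (\<lambda>x. f x - p x) v = 0))"
  have coeff: "fourier_coeff (\<lambda>x. f x - trig_poly A c x) k = fourier_coeff f k - c k" if "k \<in> A" for c k
    using that assms A fourier_coeff_trig_poly[OF A, of c k]
    unfolding fourier_coeff_def by (subst L2_inner_diff_left) auto
  have "P (trig_poly A (fourier_coeff f))"
    using assms A coeff
    by (auto simp: P_def trig_span_eq L2_inner_trig_poly_right L2_diff simp flip: A_def)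
  hence "P (\<Pi>proj n f)"
    unfolding \<Pi>proj_def orth_proj_def P_def[symmetric] by (rule someI[of P])
  moreover from this obtain c where c: "\<Pi>proj n f = trig_poly A c"
    by (auto simp: P_def trig_span_eq A_def)
  ultimately have orth: "L2_inner (\<lambda>x. f x - trig_poly A c x) v = 0" if "v \<in> trig_span n" for v
    using that by (simp add: P_def)
  have "c k = fourier_coeff f k" if "k \<in> A" for k
  proof -
    have "fourier_mode k \<in> trig_span n"
      unfolding trig_span_eq using that
      by (intro image_eqI[of _ _ "\<lambda>j. if j = k then 1 else 0"])
         (auto simp: trig_poly_def A_def fun_eq_iff if_distrib[of "\<lambda>c. c * _"] cong: if_cong)
    hence "fourier_coeff (\<lambda>x. f x - trig_poly A c x) k = 0"
      using orth by (simp add: fourier_coeff_def)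
    thus ?thesis using coeff[OF that] by simp
  qed
  thus ?thesis using c by (auto simp: trig_poly_def fun_eq_iff A_def)
qed

lemma \<Pi>proj_L2 [simp, intro]: "f \<in> L2 \<Longrightarrow> \<Pi>proj n f \<in> L2"
  by (simp add: \<Pi>proj_eq)

lemma \<Pi>proj_pythagoras:
  assumes "f \<in> L2"
  shows "(L2_norm f)\<^sup>2 = (L2_norm (\<lambda>x. f x - \<Pi>proj n f x))\<^sup>2 + (L2_norm (\<Pi>proj n f))\<^sup>2"
proof -
  have "trig_poly {- int n..int n} (\<lambda>_. 0) = (\<lambda>x. 0)" by (simp add: trig_poly_def fun_eq_iff)
  thus ?thesis
    using L2_norm_sq_diff_trig_poly[OF _ assms, of "{- int n..int n}" "\<lambda>_. 0"]
    by (simp add: \<Pi>proj_eq assms L2_norm_trig_poly)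
qed

lemma \<Pi>proj_contraction: "f \<in> L2 \<Longrightarrow> L2_norm (\<Pi>proj n f) \<le> L2_norm f"
  using \<Pi>proj_pythagoras[of f n] by (intro power2_le_imp_le[of "L2_norm (\<Pi>proj n f)"]) auto

lemma L2_norm_diff_\<Pi>proj_le: "f \<in> L2 \<Longrightarrow> L2_norm (\<lambda>x. f x - \<Pi>proj n f x) \<le> L2_norm f"
  using \<Pi>proj_pythagoras[of f n] by (intro power2_le_imp_le[of "L2_norm (\<lambda>x. f x - \<Pi>proj n f x)"]) auto

lemma \<Pi>proj_add: "f \<in> L2 \<Longrightarrow> g \<in> L2 \<Longrightarrow> \<Pi>proj n (\<lambda>x. f x + g x) = (\<lambda>x. \<Pi>proj n f x + \<Pi>proj n g x)"
  by (auto simp: \<Pi>proj_eq L2_add trig_poly_def fourier_coeff_def L2_inner_add_left ring_distribs sum.distrib)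

lemma \<Pi>proj_cong: "f \<doteq> g \<Longrightarrow> f \<in> L2 \<Longrightarrow> g \<in> L2 \<Longrightarrow> \<Pi>proj n f = \<Pi>proj n g"
  by (simp add: \<Pi>proj_eq fourier_coeff_def[abs_def] L2_inner_cong_left[of f g])

lemma \<Pi>proj_cmult: "f \<in> L2 \<Longrightarrow> \<Pi>proj n (\<lambda>x. c * f x) = (\<lambda>x. c * \<Pi>proj n f x)"
  by (auto simp: \<Pi>proj_eq L2_cmult trig_poly_def fourier_coeff_def L2_inner_cmult_left sum_distrib_left mult.assoc)

section \<open>Density of the trigonometric polynomials\<close>

lemma trig_poly_extend:
  assumes "finite B" "A \<subseteq> B"
  shows "trig_poly A c = trig_poly B (\<lambda>k. if k \<in> A then c k else 0)"
  using assms by (auto simp: trig_poly_def fun_eq_iff if_distrib[of "\<lambda>c. c * _"] sum.inter_restrict[symmetric] Int_absorb1 cong: if_cong)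

lemma trig_span_mono: "m \<le> n \<Longrightarrow> trig_span m \<subseteq> trig_span n"
  unfolding trig_span_eq using trig_poly_extend[of "{- int n..int n}" "{- int m..int m}"] by auto

lemma trig_span_add:
  assumes "f \<in> trig_span m" "g \<in> trig_span n"
  shows "(\<lambda>x. f x + g x) \<in> trig_span (max m n)"
proof -
  have "f \<in> trig_span (max m n)" "g \<in> trig_span (max m n)"
    using assms trig_span_mono by (meson max.cobounded1 max.cobounded2 subsetD)+
  then obtain c d where "f = trig_poly {- int (max m n)..int (max m n)} c"
    "g = trig_poly {- int (max m n)..int (max m n)} d"
    by (auto simp: trig_span_eq)
  thus ?thesis
    unfolding trig_span_eq
    by (intro image_eqI[of _ _ "\<lambda>k. c k + d k"]) (auto simp: trig_poly_def ring_distribs sum.distrib)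
qed

text \<open>
  Unlike each single \<open>trig_span n\<close>, the union is an algebra, which is what Stone--Weierstrass
  calls for.
\<close>

definition trig_polys :: "(real \<Rightarrow> complex) set" where
  "trig_polys = (\<Union>n. trig_span n)"

lemma trig_polys_add: "f \<in> trig_polys \<Longrightarrow> g \<in> trig_polys \<Longrightarrow> (\<lambda>x. f x + g x) \<in> trig_polys"
  unfolding trig_polys_def using trig_span_add by blast

lemma trig_polys_mode: "(\<lambda>x. c * fourier_mode k x) \<in> trig_polys"
proof -
  have "(\<lambda>x. c * fourier_mode k x) \<in> trig_span (nat \<bar>k\<bar>)"
    unfolding trig_span_eq
    by (intro image_eqI[of _ _ "\<lambda>j. if j = k then c else 0"])
       (auto simp: trig_poly_def fun_eq_iff if_distrib[of "\<lambda>c. c * _"] cong: if_cong)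
  thus ?thesis by (auto simp: trig_polys_def)
qed

lemma trig_polys_const: "(\<lambda>x. c) \<in> trig_polys"
  using trig_polys_mode[of c 0] by simp

lemma trig_polys_sum:
  "(\<And>i. i \<in> A \<Longrightarrow> f i \<in> trig_polys) \<Longrightarrow> (\<lambda>x. \<Sum>i\<in>A. f i x) \<in> trig_polys"
  by (induction A rule: infinite_finite_induct) (auto intro: trig_polys_add trig_polys_const)

lemma trig_polys_E:
  assumes "f \<in> trig_polys"
  obtains A c where "f = trig_poly A c"
  using assms unfolding trig_polys_def trig_span_eq by blast

lemma trig_polys_mult:
  assumes "f \<in> trig_polys" "g \<in> trig_polys"
  shows "(\<lambda>x. f x * g x) \<in> trig_polys"
proof -
  from assms obtain A c B d where "f = trig_poly A c" "g = trig_poly B d"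
    by (metis trig_polys_E)
  hence "(\<lambda>x. f x * g x) = (\<lambda>x. \<Sum>j\<in>A. \<Sum>k\<in>B. (c j * d k) * fourier_mode (j + k) x)"
    by (simp add: trig_poly_def sum_product fourier_mode_add mult_ac)
  thus ?thesis by (simp add: trig_polys_sum trig_polys_mode)
qed

text \<open>
  On the unit circle the coordinates are \<open>cos x\<close> and \<open>sin x\<close>, combinations of the modes \<open>1\<close> and
  \<open>-1\<close>; sums and products stay in the algebra of trigonometric polynomials.
\<close>

lemma real_polynomial_cis_trig:
  assumes "real_polynomial_function (p :: complex \<Rightarrow> real)"
  shows "(\<lambda>x. complex_of_real (p (cis x))) \<in> trig_polys"
  using assms
proof induction
  case (linear f)
  then interpret bounded_linear f .
  have f: "f (cis x) = cos x * f 1 + sin x * f \<i>" for x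
  proof -
    have "cis x = cos x *\<^sub>R 1 + sin x *\<^sub>R \<i>" by (simp add: complex_eq_iff)
    thus ?thesis by (simp only: add scaleR) simp
  qed
  have "complex_of_real (f (cis x)) =
      (complex_of_real (f 1) / 2 + complex_of_real (f \<i>) / (2 * \<i>)) * fourier_mode 1 x +
      (complex_of_real (f 1) / 2 - complex_of_real (f \<i>) / (2 * \<i>)) * fourier_mode (-1) x" for x
  proof -
    have "fourier_mode 1 x = cos x + \<i> * sin x" "fourier_mode (-1) x = cos x - \<i> * sin x"
      using cis_conv_exp[of x] cis_conv_exp[of "-x"]
      by (auto simp: fourier_mode_def complex_eq_iff)
    thus ?thesis by (simp add: f complex_eq_iff)
  qed
  thus ?case by (simp add: trig_polys_add trig_polys_mode)
qed (auto intro: trig_polys_add trig_polys_const trig_polys_mult)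

text \<open>
  The circle is the interval \<open>[-\<pi>, \<pi>]\<close> with its endpoints glued: \<open>cis\<close> maps compact sets to compact
  sets, so it is a quotient map, and a continuous function with equal boundary values descends. This
  avoids treating the discontinuity of \<open>Arg\<close> along the negative axis separately.
\<close>

lemma periodic_continuous_factor_cis:
  fixes h :: "real \<Rightarrow> 'a :: t2_space"
  assumes h: "continuous_on {-pi..pi} h" "h (-pi) = h pi"
  shows "continuous_on (sphere 0 1) (\<lambda>z. h (Arg z))" "\<And>x. x \<in> {-pi..pi} \<Longrightarrow> h (Arg (cis x)) = h x"
proof -
  show *: "h (Arg (cis x)) = h x" if "x \<in> {-pi..pi}" for x
  proof (cases "x = -pi")
    case True
    have "cis (-pi) = cis pi" by (simp add: complex_eq_iff)
    hence "Arg (cis x) = pi" using True Arg_cis[of pi] by simp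
    thus ?thesis using True h(2) by simp
  qed (use that Arg_cis[of x] in auto)
  have "closed ((\<lambda>z. h (Arg z)) -` C \<inter> sphere 0 1)" if C: "closed C" for C
  proof -
    have "(\<lambda>z. h (Arg z)) -` C \<inter> sphere 0 1 = cis ` ({-pi..pi} \<inter> h -` C)" (is "?L = ?R")
    proof (intro equalityI subsetI)
      fix z assume z: "z \<in> ?L"
      hence "cis (Arg z) = z" by (subst cis_Arg) (auto simp: sgn_eq)
      moreover have "Arg z \<in> {-pi..pi} \<inter> h -` C"
        using z mpi_less_Arg[of z] Arg_le_pi[of z] by auto
      ultimately show "z \<in> ?R" by (metis imageI)
    next
      fix z assume "z \<in> ?R"
      thus "z \<in> ?L" using * by auto
    qed
    moreover have "compact ({-pi..pi} \<inter> h -` C)"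
      using continuous_closed_preimage[OF h(1) _ C] 
      by (simp add: compact_eq_bounded_closed bounded_subset[OF bounded_closed_interval] bounded_Int)
    ultimately show ?thesis
      by (simp add: compact_imp_closed compact_continuous_image continuous_on_cis)
  qed
  thus "continuous_on (sphere 0 1) (\<lambda>z. h (Arg z))"
    by (subst continuous_on_closed_vimage) auto
qed

lemma trig_polys_uniformly_dense:
  fixes h :: "real \<Rightarrow> complex"
  assumes h: "continuous_on {-pi..pi} h" "h (-pi) = h pi" and e: "e > 0"
  obtains v where "v \<in> trig_polys" "\<And>x. x \<in> {-pi..pi} \<Longrightarrow> cmod (h x - v x) \<le> e"
proof -
  define H where "H = (\<lambda>z. h (Arg z))"
  have H: "continuous_on (sphere 0 1) H"
    unfolding H_def by (rule periodic_continuous_factor_cis[OF h])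
  have "continuous_on (sphere 0 1) (\<lambda>z. Re (H z))" "continuous_on (sphere 0 1) (\<lambda>z. Im (H z))"
    using H by (auto intro: continuous_intros)
  then obtain p q where p: "real_polynomial_function p" "\<And>z. z \<in> sphere 0 1 \<Longrightarrow> \<bar>Re (H z) - p z\<bar> < e / 2"
    and q: "real_polynomial_function q" "\<And>z. z \<in> sphere 0 1 \<Longrightarrow> \<bar>Im (H z) - q z\<bar> < e / 2"
    using e by (metis Stone_Weierstrass_real_polynomial_function compact_sphere half_gt_zero)
  define v where "v = (\<lambda>x. complex_of_real (p (cis x)) + \<i> * complex_of_real (q (cis x)))"
  have "v \<in> trig_polys"
    unfolding v_def
    by (intro trig_polys_add trig_polys_mult trig_polys_const real_polynomial_cis_trig p q)
  moreover have "cmod (h x - v x) \<le> e" if x: "x \<in> {-pi..pi}" for x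
  proof -
    have "H (cis x) = h x"
      unfolding H_def by (rule periodic_continuous_factor_cis(2)[OF h x])
    hence "\<bar>Re (h x - v x)\<bar> < e / 2" "\<bar>Im (h x - v x)\<bar> < e / 2"
      using p(2)[of "cis x"] q(2)[of "cis x"] by (auto simp: v_def)
    thus ?thesis using cmod_le[of "h x - v x"] by linarith
  qed
  ultimately show thesis by (rule that)
qed

text \<open>
  A measurable function is an almost-everywhere limit of continuous functions \<open>g\<^sub>n\<close>. Composing them
  with the nearest-point projection \<open>\<kappa>\<close> onto the disc of radius \<open>C\<close> makes them uniformly bounded,
  and multiplying by cut-offs \<open>\<phi>\<^sub>n\<close> that tend to \<open>1\<close> inside the interval makes them vanish at \<open>\<plusminus>\<pi>\<close>.
  Neither changes the limit, and the bound allows dominated convergence.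
\<close>

lemma bounded_L2_approx_continuous:
  assumes f: "f \<in> borel_measurable I\<pi>" "\<And>x. cmod (f x) \<le> C" and e: "e > 0"
  obtains h where "continuous_on UNIV h" "h (-pi) = 0" "h pi = 0" "L2_norm (\<lambda>x. f x - h x) < e"
proof -
  have "f measurable_on {-pi<..<pi}"
    using f(1) by (subst measurable_on_iff_borel_measurable) auto
  then obtain N g where N: "negligible N" and g: "\<And>n. continuous_on UNIV (g n)"
    and lim: "\<And>x. x \<notin> N \<Longrightarrow> (\<lambda>n. g n x) \<longlonglongrightarrow> (if x \<in> {-pi<..<pi} then f x else 0)"
    unfolding measurable_on_def by blast
  have C: "C \<ge> 0" using f(2)[of 0] norm_ge_zero order_trans by blast
  define \<kappa> where "\<kappa> = closest_point (cball (0 :: complex) C)"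
  have \<kappa>: "continuous_on S \<kappa>" for S
    unfolding \<kappa>_def using C by (intro continuous_on_closest_point) auto
  have \<kappa>_le: "cmod (\<kappa> z) \<le> C" for z
    using closest_point_in_set[of "cball 0 C" z] C by (auto simp: \<kappa>_def)
  have \<kappa>_id: "\<kappa> z = z" if "cmod z \<le> C" for z
    unfolding \<kappa>_def using that by (intro closest_point_self) auto
  define \<phi> where "\<phi> = (\<lambda>n x. min 1 (real n * max 0 (pi - \<bar>x\<bar>)))"
  define h where "h = (\<lambda>n x. complex_of_real (\<phi> n x) * \<kappa> (g n x))"
  have h_cont: "continuous_on S (h n)" for S n
    unfolding h_def \<phi>_def
    by (intro continuous_intros continuous_on_compose2[OF \<kappa>[of UNIV]] continuous_on_subset[OF g]) auto
  have \<phi>: "0 \<le> \<phi> n x" "\<phi> n x \<le> 1" for n x by (auto simp: \<phi>_def)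
  have h_le: "cmod (h n x) \<le> C" for n x
    using mult_mono[OF \<phi>(2)[of n x] \<kappa>_le[of "g n x"]] \<phi>(1)[of n x] C by (simp add: h_def norm_mult)
  have h_lim: "(\<lambda>n. h n x) \<longlonglongrightarrow> f x" if x: "x \<notin> N" "x \<in> {-pi<..<pi}" for x
  proof -
    have "(\<lambda>n. g n x) \<longlonglongrightarrow> f x" using lim[OF x(1)] x(2) by simp
    moreover have "isCont \<kappa> (f x)" using \<kappa>[of UNIV] by (simp add: continuous_on_eq_continuous_at)
    ultimately have "(\<lambda>n. \<kappa> (g n x)) \<longlonglongrightarrow> \<kappa> (f x)" by (rule isCont_tendsto_compose[rotated])
    hence 1: "(\<lambda>n. \<kappa> (g n x)) \<longlonglongrightarrow> f x" using \<kappa>_id f(2) by simp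
    have d: "pi - \<bar>x\<bar> > 0" using x(2) by auto
    have "eventually (\<lambda>n. \<phi> n x = 1) sequentially"
      using eventually_ge_at_top[of "nat \<lceil>1 / (pi - \<bar>x\<bar>)\<rceil>"]
    proof eventually_elim
      case (elim n)
      hence "1 / (pi - \<bar>x\<bar>) \<le> real n" by linarith
      thus ?case using d by (simp add: \<phi>_def field_simps)
    qed
    hence "(\<lambda>n. \<phi> n x) \<longlonglongrightarrow> 1" by (rule tendsto_eventually)
    hence "(\<lambda>n. h n x) \<longlonglongrightarrow> complex_of_real 1 * f x"
      unfolding h_def by (intro tendsto_intros 1)
    thus ?thesis by simp
  qed
  have "(\<lambda>n. L2_norm (\<lambda>x. f x - h n x)) \<longlonglongrightarrow> 0"
  proof (rule L2_norm_tendsto_0[OF f(1)])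
    show "h n \<in> borel_measurable I\<pi>" for n
      by (intro continuous_imp_measurable_I h_cont)
    have "AE x in lebesgue. x \<notin> N"
      using N by (intro AE_not_in) (simp add: negligible_iff_null_sets)
    hence "AE x in I\<pi>. x \<notin> N" 
      by (subst AE_restrict_space_iff) auto
    thus "AE x in I\<pi>. (\<lambda>n. h n x) \<longlonglongrightarrow> f x"
      using AE_space by eventually_elim (auto intro: h_lim)
    show "integrable I\<pi> (\<lambda>x. (2 * C)\<^sup>2)" by (rule integrable_const_I)
    have "(cmod (f x - h n x))\<^sup>2 \<le> (2 * C)\<^sup>2" for n x
      using norm_triangle_ineq4[of "f x" "h n x"] f(2)[of x] h_le[of n x] by (intro power_mono) auto
    thus "AE x in I\<pi>. (cmod (f x - h n x))\<^sup>2 \<le> (2 * C)\<^sup>2" for n by simp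
  qed
  then obtain n where "L2_norm (\<lambda>x. f x - h n x) < e"
    using e by (auto simp: lim_sequentially dist_real_def)
  moreover have "h n (-pi) = 0" "h n pi = 0" by (auto simp: h_def \<phi>_def)
  ultimately show thesis using that h_cont by blast
qed

lemma L2_approx_bounded:
  assumes f: "f \<in> L2" and e: "e > 0"
  obtains b C where "b \<in> borel_measurable I\<pi>" "\<And>x. cmod (b x) \<le> C" "L2_norm (\<lambda>x. f x - b x) < e"
proof -
  define b where "b = (\<lambda>(n::nat) x. if cmod (f x) \<le> real n then f x else 0)"
  have meas [measurable]: "f \<in> borel_measurable I\<pi>" using f by (rule L2_measurable)
  have b: "b n \<in> borel_measurable I\<pi>" for n unfolding b_def by measurable
  have "(\<lambda>n. L2_norm (\<lambda>x. f x - b n x)) \<longlonglongrightarrow> 0"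
  proof (rule L2_norm_tendsto_0[OF meas b])
    have "(\<lambda>n. b n x) \<longlonglongrightarrow> f x" for x
    proof (rule tendsto_eventually)
      show "eventually (\<lambda>n. b n x = f x) sequentially"
        using eventually_ge_at_top[of "nat \<lceil>cmod (f x)\<rceil>"]
      proof eventually_elim
        case (elim n)
        hence "cmod (f x) \<le> real n" by linarith
        thus ?case by (simp add: b_def)
      qed
    qed
    thus "AE x in I\<pi>. (\<lambda>n. b n x) \<longlonglongrightarrow> f x" by simp
    show "integrable I\<pi> (\<lambda>x. (cmod (f x))\<^sup>2)" using f by (simp add: L2_def)
    show "AE x in I\<pi>. (cmod (f x - b n x))\<^sup>2 \<le> (cmod (f x))\<^sup>2" for n by (auto simp: b_def)
  qed
  then obtain n where "L2_norm (\<lambda>x. f x - b n x) < e"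
    using e by (auto simp: lim_sequentially dist_real_def)
  moreover have "cmod (b n x) \<le> real n" for x by (auto simp: b_def)
  ultimately show thesis using that b by blast
qed

lemma trig_polys_L2: "v \<in> trig_polys \<Longrightarrow> v \<in> L2"
  by (auto elim!: trig_polys_E)

theorem trig_polys_L2_dense:
  assumes f: "f \<in> L2" and e: "e > 0"
  obtains v where "v \<in> trig_polys" "L2_norm (\<lambda>x. f x - v x) < e"
proof -
  obtain b C where b: "b \<in> borel_measurable I\<pi>" "\<And>x. cmod (b x) \<le> C" "L2_norm (\<lambda>x. f x - b x) < e / 3"
    using L2_approx_bounded[OF f, of "e / 3"] e by auto
  obtain h where h: "continuous_on UNIV h" "h (-pi) = 0" "h pi = 0" "L2_norm (\<lambda>x. b x - h x) < e / 3"
    using bounded_L2_approx_continuous[OF b(1,2), of "e / 3"] e by auto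
  obtain v where v: "v \<in> trig_polys" "\<And>x. x \<in> {-pi..pi} \<Longrightarrow> cmod (h x - v x) \<le> e / 3"
    using trig_polys_uniformly_dense[of h "e / 3"] h e by (auto intro: continuous_on_subset)
  have hv: "(\<lambda>x. h x - v x) \<in> borel_measurable I\<pi>"
    using trig_polys_L2[OF v(1), THEN L2_measurable]
      continuous_imp_measurable_I[OF continuous_on_subset[OF h(1)]] by auto
  have L2: "b \<in> L2" "(\<lambda>x. h x - v x) \<in> L2"
    using L2_bounded_measurable[OF b(1), of C] L2_bounded_measurable[OF hv, of "e / 3"] b(2) v(2) by auto
  have "h \<in> L2" using L2_add[OF L2(2) trig_polys_L2[OF v(1)]] by simp
  hence L2': "(\<lambda>x. f x - b x) \<in> L2" "(\<lambda>x. b x - h x) \<in> L2" using f L2 by auto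
  have "L2_norm (\<lambda>x. f x - v x) = L2_norm (\<lambda>x. (f x - b x) + ((b x - h x) + (h x - v x)))"
    by simp
  also have "\<dots> \<le> L2_norm (\<lambda>x. f x - b x) + L2_norm (\<lambda>x. (b x - h x) + (h x - v x))"
    using L2' L2 by (intro L2_norm_triangle L2_add)
  also have "\<dots> \<le> L2_norm (\<lambda>x. f x - b x) + (L2_norm (\<lambda>x. b x - h x) + L2_norm (\<lambda>x. h x - v x))"
    using L2' L2 by (intro add_left_mono L2_norm_triangle)
  also have "L2_norm (\<lambda>x. h x - v x) \<le> e / 3"
    using v(2) by (intro L2_norm_bound hv) auto
  finally have "L2_norm (\<lambda>x. f x - v x) < e" using b(3) h(4) by linarith
  thus thesis using v(1) that by blast
qed

section \<open>Decay of Fourier coefficients and projection error\<close>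

text \<open>
  This is one half of Parseval's identity. For large \<open>N\<close>, density together with the best-approximation
  property of Fourier sums makes \<open>f - \<Pi>\<^sub>N f\<close> negligible, and the passage from \<open>\<Pi>\<^sub>n\<close> to \<open>\<Pi>\<^sub>N\<close> costs the
  coefficients in between.
\<close>

lemma L2_norm_sq_diff_\<Pi>proj_le:
  assumes f: "f \<in> L2"
    and S: "\<And>N. n \<le> N \<Longrightarrow> (\<Sum>k\<in>{- int N..int N} - {- int n..int n}. (cmod (fourier_coeff f k))\<^sup>2) \<le> S"
  shows "(L2_norm (\<lambda>x. f x - \<Pi>proj n f x))\<^sup>2 \<le> S"
proof (rule field_le_epsilon)
  fix e :: real assume e: "e > 0"
  obtain v where v: "v \<in> trig_polys" "L2_norm (\<lambda>x. f x - v x) < sqrt e"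
    using trig_polys_L2_dense[OF f, of "sqrt e"] e by auto
  then obtain m where "v \<in> trig_span m" by (auto simp: trig_polys_def)
  define N where "N = max m n"
  define A where "A = {- int N..int N}"
  define B where "B = {- int n..int n}"
  have AB: "finite A" "B \<subseteq> A" "n \<le> N" by (auto simp: A_def B_def N_def)
  have "v \<in> trig_span N"
    using \<open>v \<in> trig_span m\<close> trig_span_mono[of m N] by (auto simp: N_def)
  then obtain c where c: "v = trig_poly A c" by (auto simp: trig_span_eq A_def)
  have "(L2_norm (\<lambda>x. f x - trig_poly A (fourier_coeff f) x))\<^sup>2 \<le> (L2_norm (\<lambda>x. f x - v x))\<^sup>2"
    using L2_norm_sq_diff_trig_poly[OF AB(1) f, of c] by (simp add: c sum_nonneg)
  also have "\<dots> \<le> (sqrt e)\<^sup>2"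
    using v(2) by (intro power_mono) auto
  also have "\<dots> = e" using e by simp
  finally have best: "(L2_norm (\<lambda>x. f x - trig_poly A (fourier_coeff f) x))\<^sup>2 \<le> e" .
  have "\<Pi>proj n f = trig_poly A (\<lambda>k. if k \<in> B then fourier_coeff f k else 0)"
    using f AB trig_poly_extend[of A B] by (simp add: \<Pi>proj_eq flip: B_def)
  hence "(L2_norm (\<lambda>x. f x - \<Pi>proj n f x))\<^sup>2 =
      (L2_norm (\<lambda>x. f x - trig_poly A (fourier_coeff f) x))\<^sup>2 +
      (\<Sum>k\<in>A. (cmod (fourier_coeff f k - (if k \<in> B then fourier_coeff f k else 0)))\<^sup>2)"
    by (simp only: L2_norm_sq_diff_trig_poly[OF AB(1) f, of "\<lambda>k. if k \<in> B then fourier_coeff f k else 0"])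
  also have "\<dots> \<le> e +
      (\<Sum>k\<in>A. (cmod (fourier_coeff f k - (if k \<in> B then fourier_coeff f k else 0)))\<^sup>2)"
    using best by (rule add_right_mono)
  also have "(\<Sum>k\<in>A. (cmod (fourier_coeff f k - (if k \<in> B then fourier_coeff f k else 0)))\<^sup>2) =
      (\<Sum>k\<in>A - B. (cmod (fourier_coeff f k))\<^sup>2)"
    using AB(1) by (intro sum.mono_neutral_cong_right) auto
  also have "\<dots> \<le> S" unfolding A_def B_def by (rule S) (rule AB)
  finally show "(L2_norm (\<lambda>x. f x - \<Pi>proj n f x))\<^sup>2 \<le> S + e" by simp
qed

text \<open>
  On either side the sum is dominated by the telescoping series of \<open>1 / (k (k - 1))\<close>.
\<close>

lemma sum_inverse_squares_tail:
  assumes "1 \<le> n" "n \<le> N"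
  shows "(\<Sum>k\<in>{- int N..int N} - {- int n..int n}. 1 / (real_of_int k)\<^sup>2) \<le> 2 / real n"
proof -
  have *: "(\<Sum>k=n+1..N. 1 / (real k)\<^sup>2) \<le> 1 / real n - 1 / real N"
    using \<open>n \<le> N\<close>
  proof (induction N rule: dec_induct)
    case (step N)
    have N: "real N > 0" using step assms by simp
    have "1 / (real (Suc N))\<^sup>2 \<le> 1 / (real N * real (Suc N))"
      using N by (intro divide_left_mono) (auto simp: power2_eq_square)
    also have "\<dots> = 1 / real N - 1 / real (Suc N)"
      using N by (simp add: field_simps)
    finally show ?case using step by simp
  qed simp
  have D: "{- int N..int N} - {- int n..int n} = int ` {n+1..N} \<union> (\<lambda>k. - int k) ` {n+1..N}"
  proof (intro equalityI subsetI)
    fix k assume k: "k \<in> {- int N..int N} - {- int n..int n}"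
    show "k \<in> int ` {n+1..N} \<union> (\<lambda>k. - int k) ` {n+1..N}"
    proof (cases "k \<ge> 0")
      case True
      thus ?thesis using k by (intro UnI1 image_eqI[of _ _ "nat k"]) auto
    next
      case False
      thus ?thesis using k by (intro UnI2 image_eqI[of _ _ "nat (-k)"]) auto
    qed
  qed auto
  have "(\<Sum>k\<in>{- int N..int N} - {- int n..int n}. 1 / (real_of_int k)\<^sup>2) =
      (\<Sum>k\<in>int ` {n+1..N}. 1 / (real_of_int k)\<^sup>2) + (\<Sum>k\<in>(\<lambda>k. - int k) ` {n+1..N}. 1 / (real_of_int k)\<^sup>2)"
    unfolding D by (intro sum.union_disjoint) auto
  also have "\<dots> = 2 * (\<Sum>k=n+1..N. 1 / (real k)\<^sup>2)"
    by (simp add: sum.reindex inj_on_def)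
  also have "\<dots> \<le> 2 * (1 / real n)" using order_trans[OF *, of "1 / real n"] by simp
  finally show ?thesis by simp
qed

text \<open>
  For \<open>|k| > n\<close> one splits \<open>|k| powr (-2q) = |k| powr (2 - 2q) * |k| powr (-2)\<close>. The first factor is at
  most \<open>n powr (2 - 2q)\<close> since \<open>q \<ge> 1\<close>, and the second sums to at most \<open>2 / n\<close>. The product
  \<open>2 n powr (1 - 2q)\<close> is rounded up to \<open>4 n powr (1 - 2q)\<close> for a square root without surds.
\<close>

lemma \<Pi>proj_error_of_fourier_decay:
  assumes f: "f \<in> L2" and q: "q \<ge> 1" and C: "C \<ge> 0" and n: "n \<ge> 1"
    and decay: "\<And>k. \<bar>k\<bar> \<ge> int n \<Longrightarrow> cmod (fourier_coeff f k) \<le> C * \<bar>real_of_int k\<bar> powr (- q)"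
  shows "L2_norm (\<lambda>x. f x - \<Pi>proj n f x) \<le> 2 * C * real n powr (- q + 1 / 2)"
proof (rule power2_le_imp_le)
  define S where "S = C\<^sup>2 * real n powr (2 - 2 * q) * (2 / real n)"
  have "(L2_norm (\<lambda>x. f x - \<Pi>proj n f x))\<^sup>2 \<le> S"
  proof (rule L2_norm_sq_diff_\<Pi>proj_le[OF f])
    fix N assume N: "n \<le> N"
    have "(cmod (fourier_coeff f k))\<^sup>2 \<le> C\<^sup>2 * real n powr (2 - 2 * q) * (1 / (real_of_int k)\<^sup>2)"
      if k: "k \<in> {- int N..int N} - {- int n..int n}" for k
    proof -
      define t where "t = \<bar>real_of_int k\<bar>"
      have t: "t \<ge> real n" "t > 0" using k n by (auto simp: t_def)
      have "(cmod (fourier_coeff f k))\<^sup>2 \<le> (C * t powr (- q))\<^sup>2"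
        using decay[of k] k by (intro power_mono) (auto simp: t_def)
      also have "\<dots> = C\<^sup>2 * (t powr (2 - 2 * q) * t powr (- 2))"
        by (simp add: power_mult_distrib power2_eq_square flip: powr_add)
      also have "t powr (- 2) = 1 / (real_of_int k)\<^sup>2"
        using t by (simp add: powr_minus_divide t_def flip: powr_realpow)
      also have "t powr (2 - 2 * q) \<le> real n powr (2 - 2 * q)"
        using t n q by (intro powr_mono2') auto
      finally show ?thesis by (simp add: mult_left_mono mult_right_mono divide_right_mono)
    qed
    hence "(\<Sum>k\<in>{- int N..int N} - {- int n..int n}. (cmod (fourier_coeff f k))\<^sup>2) \<le>
        (\<Sum>k\<in>{- int N..int N} - {- int n..int n}. C\<^sup>2 * real n powr (2 - 2 * q) * (1 / (real_of_int k)\<^sup>2))"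
      by (rule sum_mono)
    also have "\<dots> \<le> S"
      unfolding S_def sum_distrib_left[symmetric]
      by (intro mult_left_mono sum_inverse_squares_tail n N) auto
    finally show "(\<Sum>k\<in>{- int N..int N} - {- int n..int n}. (cmod (fourier_coeff f k))\<^sup>2) \<le> S" .
  qed
  also have "S = 2 * (C\<^sup>2 * real n powr (1 - 2 * q))"
  proof -
    have "real n powr (2 - 2 * q) = real n powr (1 - 2 * q) * real n"
      using n powr_add[of "real n" "1 - 2 * q" 1] by simp
    thus ?thesis using n by (simp add: S_def)
  qed
  also have "\<dots> \<le> 4 * (C\<^sup>2 * real n powr (1 - 2 * q))"
    by (intro mult_right_mono) auto
  also have "\<dots> = (2 * C * real n powr (- q + 1 / 2))\<^sup>2"
    by (simp add: power_mult_distrib power2_eq_square flip: powr_add)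
  finally show "(L2_norm (\<lambda>x. f x - \<Pi>proj n f x))\<^sup>2 \<le> (2 * C * real n powr (- q + 1 / 2))\<^sup>2" .
qed (use C in auto)

lemma \<O>_class_decay:
  assumes "h \<in> \<O>_class q"
  obtains C N where "C \<ge> 0"
    "\<And>k. \<bar>k\<bar> \<ge> int N \<Longrightarrow> cmod (fourier_coeff h k) \<le> C * \<bar>real_of_int k\<bar> powr (- q)"
proof -
  from assms obtain c where c: "c > 0"
    "eventually (\<lambda>k. cmod (fourier_coeff h k) \<le> c * \<bar>real_of_int k\<bar> powr (- q)) at_top"
    by (auto simp: \<O>_class_def elim!: landau_o.bigE)
  from assms obtain d where d: "d > 0"
    "eventually (\<lambda>k. cmod (fourier_coeff h k) \<le> d * \<bar>real_of_int k\<bar> powr (- q)) at_bot"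
    by (auto simp: \<O>_class_def elim!: landau_o.bigE)
  obtain a b where a: "\<And>k. k \<ge> a \<Longrightarrow> cmod (fourier_coeff h k) \<le> c * \<bar>real_of_int k\<bar> powr (- q)"
    and b: "\<And>k. k \<le> b \<Longrightarrow> cmod (fourier_coeff h k) \<le> d * \<bar>real_of_int k\<bar> powr (- q)"
    using c(2) d(2) by (auto simp: eventually_at_top_linorder eventually_at_bot_linorder)
  show thesis
  proof (rule that[of "max c d" "nat (max \<bar>a\<bar> \<bar>b\<bar>)"])
    fix k :: int assume k: "\<bar>k\<bar> \<ge> int (nat (max \<bar>a\<bar> \<bar>b\<bar>))"
    have k: "\<bar>a\<bar> \<le> \<bar>k\<bar>" "\<bar>b\<bar> \<le> \<bar>k\<bar>" using k by (auto simp: max_def split: if_splits)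
    have le: "c * \<bar>real_of_int k\<bar> powr (- q) \<le> max c d * \<bar>real_of_int k\<bar> powr (- q)"
      "d * \<bar>real_of_int k\<bar> powr (- q) \<le> max c d * \<bar>real_of_int k\<bar> powr (- q)"
      by (intro mult_right_mono; simp)+
    show "cmod (fourier_coeff h k) \<le> max c d * \<bar>real_of_int k\<bar> powr (- q)"
    proof (cases "k \<ge> 0")
      case True
      hence "k \<ge> a" using k by linarith
      thus ?thesis using a le by (meson order_trans)
    next
      case False
      hence "k \<le> b" using k by linarith
      thus ?thesis using b le by (meson order_trans)
    qed
  qed (use c in auto)
qed

lemma periodic_ext_eq: "x \<in> {-pi<..<pi} \<Longrightarrow> periodic_ext h x = h x"
proof -
  assume "x \<in> {-pi<..<pi}"
  hence "\<lfloor>(x + pi) / (2 * pi)\<rfloor> = 0" by (simp add: floor_eq_iff)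
  thus ?thesis by (simp add: periodic_ext_def)
qed

lemma fourier_coeff_periodic_ext: "fourier_coeff (periodic_ext h) k = fourier_coeff h k"
proof -
  have "(LINT x|I\<pi>. periodic_ext h x * cnj (fourier_mode k x)) = (LINT x|I\<pi>. h x * cnj (fourier_mode k x))"
    by (intro Bochner_Integration.integral_cong) (auto simp: periodic_ext_eq)
  thus ?thesis by (simp add: fourier_coeff_def L2_inner_def)
qed

lemma integrable_periodic_ext_iff: "integrable I\<pi> (periodic_ext h) \<longleftrightarrow> integrable I\<pi> h"
  by (intro Bochner_Integration.integrable_cong) (auto simp: periodic_ext_eq)

section \<open>The set where the multiplication part equals the eigenvalue\<close>

text \<open>
  The conclusion asks for arbitrarily large degree because this is what the induction needs: of two
  solutions \<open>p\<close>, \<open>r\<close> for the smaller set of functionals, with \<open>degree p < degree r\<close>, the combination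
  on which one more functional vanishes has the degree of \<open>r\<close>, hence is not zero.
\<close>

lemma finitely_many_functionals_vanish_on_poly:
  fixes \<Phi> :: "('a :: field poly \<Rightarrow> 'a) set"
  assumes "finite \<Phi>" 
    and "\<And>\<phi> p q. \<phi> \<in> \<Phi> \<Longrightarrow> \<phi> (p + q) = \<phi> p + \<phi> q"
    and "\<And>\<phi> c p. \<phi> \<in> \<Phi> \<Longrightarrow> \<phi> (smult c p) = c * \<phi> p"
  shows "\<exists>p. degree p > d \<and> (\<forall>\<phi>\<in>\<Phi>. \<phi> p = 0)"
  using assms
proof (induction \<Phi> arbitrary: d rule: finite_induct)
  case empty
  show ?case by (rule exI[of _ "monom 1 (Suc d)"]) (simp add: degree_monom_eq)
next
  case (insert \<phi> \<Phi>)
  obtain p where p: "degree p > d" "\<forall>\<psi>\<in>\<Phi>. \<psi> p = 0" using insert.IH[of d] insert.prems by auto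
  obtain r where r: "degree r > degree p" "\<forall>\<psi>\<in>\<Phi>. \<psi> r = 0" using insert.IH[of "degree p"] insert.prems by auto
  show ?case
  proof (cases "\<phi> p = 0")
    case True
    thus ?thesis using p by auto
  next
    case False
    define w where "w = smult (\<phi> p) r + smult (- \<phi> r) p"
    have "degree w = degree r"
      unfolding w_def using False r(1) by (subst degree_add_eq_left) (auto intro: le_less_trans[OF degree_smult_le])
    moreover have "\<psi> w = 0" if "\<psi> \<in> insert \<phi> \<Phi>" for \<psi>
    proof -
      have "\<psi> w = \<phi> p * \<psi> r + (- \<phi> r) * \<psi> p"
        unfolding w_def by (simp only: insert.prems[OF that])
      thus ?thesis using that p(2) r(2) by (cases "\<psi> = \<phi>") auto
    qed
    ultimately show ?thesis using p r by (intro exI[of _ w]) auto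
  qed
qed

lemma L2_on_set_poly:
  assumes "Measurable.pred I\<pi> P"
  shows "(\<lambda>x. if P x then poly p (complex_of_real x) else 0) \<in> L2"
proof -
  have cont: "continuous_on S (\<lambda>x. poly p (complex_of_real x))" for S
    by (intro continuous_intros)
  have "bounded ((\<lambda>x. poly p (complex_of_real x)) ` {-pi..pi})"
    by (intro compact_imp_bounded compact_continuous_image cont compact_Icc)
  then obtain C where C: "\<forall>x\<in>{-pi..pi}. cmod (poly p (complex_of_real x)) \<le> C"
    unfolding bounded_iff by blast
  show ?thesis
  proof (rule L2_bounded_measurable[where C = "max 0 C"])
    show "(\<lambda>x. if P x then poly p (complex_of_real x) else 0) \<in> borel_measurable I\<pi>"
      using assms continuous_imp_measurable_I[OF cont] by measurable
  qed (use C in \<open>auto simp: le_max_iff_disj\<close>)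
qed

text \<open>
  Let \<open>B\<close> be a finite set spanning the eigenspace. The functions \<open>u p\<close>, equal to a polynomial \<open>p\<close> on
  \<open>{s = lam}\<close> and to zero elsewhere, form an infinite-dimensional family, so some \<open>u p\<close> with
  \<open>p \<noteq> 0\<close> is orthogonal to all \<open>g\<^sub>j\<close> and to all of \<open>B\<close>. The first makes it an eigenfunction, hence
  a combination of \<open>B\<close>; the second then makes it orthogonal to itself. So \<open>p\<close> vanishes almost
  everywhere on \<open>{s = lam}\<close>. As \<open>p\<close> has only finitely many roots, that set is null. Orthogonality to
  \<open>B\<close> takes the place of a dimension count modulo equality almost everywhere.
\<close>

lemma finite_multiplicity_imp_AE_ne:
  assumes s: "s \<in> borel_measurable I\<pi>"
    and g: "\<forall>j\<in>{1..l}. g j \<in> L2"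
    and fin: "finite_multiplicity (op_M s l g) lam"
  shows "AE x in I\<pi>. lam \<noteq> complex_of_real (s x)"
proof -
  obtain B where B: "finite B" "B \<subseteq> eigenspace (op_M s l g) lam"
    and span: "\<And>f. f \<in> eigenspace (op_M s l g) lam \<Longrightarrow> \<exists>c. f \<doteq> (\<lambda>x. \<Sum>b\<in>B. c b * b x)"
    using fin by (auto simp: finite_multiplicity_def)
  define u where "u = (\<lambda>p x. if lam = complex_of_real (s x) then poly p (complex_of_real x) else 0)"
  have "Measurable.pred I\<pi> (\<lambda>x. lam = complex_of_real (s x))"
    using s by measurable
  hence u: "u p \<in> L2" for p unfolding u_def by (rule L2_on_set_poly)
  define H where "H = B \<union> g ` {1..l}"
  have H: "finite H" "h \<in> H \<Longrightarrow> h \<in> L2" for h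
    using B g by (auto simp: H_def eigenspace_def)
  have u_lin: "u (p + r) = (\<lambda>x. u p x + u r x)" "u (smult c p) = (\<lambda>x. c * u p x)" for p r c
    by (auto simp: u_def)
  have "\<exists>p. degree p > 0 \<and> (\<forall>\<phi>\<in>(\<lambda>h p. L2_inner (u p) h) ` H. \<phi> p = 0)"
    using H(1)
    by (intro finitely_many_functionals_vanish_on_poly)
       (auto simp: u_lin L2_inner_cmult_left L2_inner_add_left[OF u u H(2)])
  then obtain p where p: "degree p > 0" and orth: "\<And>h. h \<in> H \<Longrightarrow> L2_inner (u p) h = 0"
    by auto
  have "op_K l g (u p) = (\<lambda>x. 0)"
    using orth by (simp add: op_K_def H_def)
  moreover have "op_S s (u p) = (\<lambda>x. lam * u p x)"
    by (auto simp: op_S_def u_def)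
  ultimately have "op_M s l g (u p) = (\<lambda>x. lam * u p x)"
    by (simp add: op_M_def)
  hence "u p \<in> eigenspace (op_M s l g) lam"
    using u by (simp add: eigenspace_def L2_eq_def)
  then obtain c where c: "u p \<doteq> (\<lambda>x. \<Sum>b\<in>B. c b * b x)"
    using span by blast
  have BL2: "b \<in> L2" if "b \<in> B" for b using H(2) that by (auto simp: H_def)
  have sum_L2: "(\<lambda>x. \<Sum>b\<in>B. c b * b x) \<in> L2"
    by (intro L2_sum L2_cmult BL2)
  have "L2_inner (u p) (u p) = L2_inner (\<lambda>x. \<Sum>b\<in>B. c b * b x) (u p)"
    by (rule L2_inner_cong_left[OF c u sum_L2 u])
  also have "\<dots> = (\<Sum>b\<in>B. c b * cnj (L2_inner (u p) b))"
    using BL2 u by (subst L2_inner_sum_left) (auto simp: L2_inner_cmult_left L2_inner_cnj)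
  also have "\<dots> = 0" using orth by (simp add: H_def)
  finally have "L2_norm (u p) = 0" by (simp add: L2_inner_self_norm)
  hence "AE x in I\<pi>. u p x = 0"
    using L2_norm_eq_0[OF u] by (simp add: L2_eq_def)
  moreover have "AE x in I\<pi>. poly p (complex_of_real x) \<noteq> 0"
  proof -
    have "finite (complex_of_real -` {z. poly p z = 0})"
      using p by (intro finite_vimageI poly_roots_finite) (auto simp: inj_on_def)
    hence "AE x in lebesgue. x \<notin> complex_of_real -` {z. poly p z = 0}"
      by (intro AE_not_in) (simp add: negligible_finite flip: negligible_iff_null_sets)
    thus ?thesis by (subst AE_restrict_space_iff) auto
  qed
  ultimately show ?thesis
    by eventually_elim (auto simp: u_def)
qed

section \<open>The operator and its eigenfunctions\<close>

lemma op_S_L2: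
  assumes s: "s \<in> borel_measurable I\<pi>" "\<And>x. x \<in> {-pi<..<pi} \<Longrightarrow> \<bar>s x\<bar> \<le> b"
    and f: "f \<in> L2"
  shows "op_S s f \<in> L2" "L2_norm (op_S s f) \<le> b * L2_norm f"
proof -
  have b: "b \<ge> 0" using s(2)[of 0] by simp
  have meas: "op_S s f \<in> borel_measurable I\<pi>"
    using s(1) L2_measurable[OF f] unfolding op_S_def by measurable
  have bound: "(cmod (op_S s f x))\<^sup>2 \<le> b\<^sup>2 * (cmod (f x))\<^sup>2" if "x \<in> {-pi<..<pi}" for x
    using s(2)[OF that] by (auto simp: op_S_def norm_mult power_mult_distrib intro!: mult_right_mono abs_le_square_iff[THEN iffD1])
  have int: "integrable I\<pi> (\<lambda>x. b\<^sup>2 * (cmod (f x))\<^sup>2)" using f by (simp add: L2_def)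
  have int': "integrable I\<pi> (\<lambda>x. (cmod (op_S s f x))\<^sup>2)"
    using meas bound by (intro Bochner_Integration.integrable_bound[OF int]) (auto intro!: AE_I2)
  thus L2: "op_S s f \<in> L2" using meas by (simp add: L2_def)
  have "(LINT x|I\<pi>. (cmod (op_S s f x))\<^sup>2) \<le> (LINT x|I\<pi>. b\<^sup>2 * (cmod (f x))\<^sup>2)"
    using bound by (intro integral_mono int int') auto
  hence "(L2_norm (op_S s f))\<^sup>2 \<le> (b * L2_norm f)\<^sup>2"
    by (simp add: L2_norm_sq power_mult_distrib divide_right_mono)
  thus "L2_norm (op_S s f) \<le> b * L2_norm f"
    by (rule power2_le_imp_le) (simp add: b)
qed

lemma op_K_L2:
  assumes g: "\<forall>j\<in>{1..l}. g j \<in> L2" and f: "f \<in> L2"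
  shows "op_K l g f \<in> L2" "L2_norm (op_K l g f) \<le> (\<Sum>j=1..l. (L2_norm (g j))\<^sup>2) * L2_norm f"
proof -
  show "op_K l g f \<in> L2"
    unfolding op_K_def using g by (intro L2_sum L2_cmult) auto
  have "L2_norm (op_K l g f) \<le> (\<Sum>j=1..l. L2_norm (\<lambda>x. L2_inner f (g j) * g j x))"
    unfolding op_K_def using g by (intro L2_norm_sum L2_cmult) auto
  also have "\<dots> \<le> (\<Sum>j=1..l. (L2_norm (g j))\<^sup>2 * L2_norm f)"
  proof (intro sum_mono)
    fix j assume j: "j \<in> {1..l}"
    have "L2_norm (\<lambda>x. L2_inner f (g j) * g j x) \<le> (L2_norm f * L2_norm (g j)) * L2_norm (g j)"
      unfolding L2_norm_cmult using f g j by (intro mult_right_mono L2_Cauchy_Schwarz) auto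
    thus "L2_norm (\<lambda>x. L2_inner f (g j) * g j x) \<le> (L2_norm (g j))\<^sup>2 * L2_norm f"
      by (simp add: power2_eq_square mult_ac)
  qed
  finally show "L2_norm (op_K l g f) \<le> (\<Sum>j=1..l. (L2_norm (g j))\<^sup>2) * L2_norm f"
    by (simp add: sum_distrib_right)
qed

lemma op_M_add:
  assumes "\<forall>j\<in>{1..l}. g j \<in> L2" "f \<in> L2" "h \<in> L2"
  shows "op_M s l g (\<lambda>x. f x + h x) = (\<lambda>x. op_M s l g f x + op_M s l g h x)"
  using assms by (simp add: op_M_def op_S_def op_K_def L2_inner_add_left ring_distribs sum.distrib fun_eq_iff)

lemma op_M_cmult: "op_M s l g (\<lambda>x. c * f x) = (\<lambda>x. c * op_M s l g f x)"
  by (simp add: op_M_def op_S_def op_K_def L2_inner_cmult_left ring_distribs sum_distrib_left mult_ac fun_eq_iff)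

lemma op_M_cong:
  assumes "\<forall>j\<in>{1..l}. g j \<in> L2" "f \<in> L2" "h \<in> L2" "f \<doteq> h"
  shows "op_M s l g f \<doteq> op_M s l g h"
proof -
  have K: "op_K l g f = op_K l g h"
    using assms by (simp add: op_K_def L2_inner_cong_left[of f h])
  have "AE x in I\<pi>. f x = h x" using assms by (simp add: L2_eq_def)
  thus ?thesis unfolding L2_eq_def by eventually_elim (simp add: op_M_def op_S_def K)
qed

lemma op_M_bounded:
  assumes s: "s \<in> borel_measurable I\<pi>" "bounded (s ` {-pi<..<pi})"
    and g: "\<forall>j\<in>{1..l}. g j \<in> L2"
  obtains C where "C \<ge> 0" "\<And>f. f \<in> L2 \<Longrightarrow> op_M s l g f \<in> L2"
    "\<And>f. f \<in> L2 \<Longrightarrow> L2_norm (op_M s l g f) \<le> C * L2_norm f"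
proof -
  obtain b where "\<forall>x\<in>{-pi<..<pi}. \<bar>s x\<bar> \<le> b"
    using s(2) by (auto simp: bounded_iff)
  hence b: "\<bar>s x\<bar> \<le> b" if "x \<in> {-pi<..<pi}" for x using that by blast
  have "b \<ge> 0" using b[of 0] by simp
  define C where "C = b + (\<Sum>j=1..l. (L2_norm (g j))\<^sup>2)"
  show thesis
  proof (rule that[of C])
    show "C \<ge> 0" using \<open>b \<ge> 0\<close> by (simp add: C_def sum_nonneg)
  next
    fix f assume f: "f \<in> L2"
    note SK = op_S_L2[OF s(1) b f] op_K_L2[OF g f]
    show "op_M s l g f \<in> L2" unfolding op_M_def using SK by (intro L2_add)
    have "L2_norm (op_M s l g f) \<le> L2_norm (op_S s f) + L2_norm (op_K l g f)"
      unfolding op_M_def using SK by (intro L2_norm_triangle)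
    also have "\<dots> \<le> C * L2_norm f" using SK by (simp add: C_def ring_distribs)
    finally show "L2_norm (op_M s l g f) \<le> C * L2_norm f" .
  qed
qed

text \<open>
  The estimate compares \<open>\<Pi>\<^sub>n \<psi>\<close> with \<open>\<psi>\<close> under the powers of the full operator \<open>M\<close>: with
  \<open>d = \<Pi>\<^sub>n \<psi> - \<psi>\<close>, the eigenvalue equation collapses \<open>\<Pi>\<^sub>n M\<^sup>k \<psi>\<close> to \<open>lam\<^sup>k \<Pi>\<^sub>n \<psi>\<close>, so everything
  left is a bounded operator applied to \<open>d\<close>.
\<close>

lemma compression_error:
  assumes s: "s \<in> borel_measurable I\<pi>" and g: "\<forall>j\<in>{1..l}. g j \<in> L2"
    and C: "C \<ge> 0" and ML2: "\<And>f. f \<in> L2 \<Longrightarrow> op_M s l g f \<in> L2"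
    and Mle: "\<And>f. f \<in> L2 \<Longrightarrow> L2_norm (op_M s l g f) \<le> C * L2_norm f"
    and \<psi>: "\<psi> \<in> L2" "op_M s l g \<psi> \<doteq> (\<lambda>x. lam * \<psi> x)"
  shows "L2_norm (\<lambda>x. \<Pi>proj n ((op_M s l g ^^ k) (\<Pi>proj n \<psi>)) x - lam ^ k * \<psi> x) \<le>
    (C ^ k + cmod lam ^ k) * L2_norm (\<lambda>x. \<psi> x - \<Pi>proj n \<psi> x)"
proof -
  define M where "M = op_M s l g"
  have pow: "(M ^^ k) f \<in> L2 \<and> L2_norm ((M ^^ k) f) \<le> C ^ k * L2_norm f" if "f \<in> L2" for f k
  proof (induction k)
    case (Suc k)
    hence "L2_norm (M ((M ^^ k) f)) \<le> C * (C ^ k * L2_norm f)"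
      using Mle[of "(M ^^ k) f"] C mult_left_mono[of "L2_norm ((M ^^ k) f)" "C ^ k * L2_norm f" C]
      by (simp add: M_def)
    thus ?case using Suc ML2 by (simp add: M_def mult.assoc)
  qed (use that in auto)
  have add: "(M ^^ k) (\<lambda>x. f x + h x) = (\<lambda>x. (M ^^ k) f x + (M ^^ k) h x)"
    if "f \<in> L2" "h \<in> L2" for f h k
  proof (induction k)
    case (Suc k)
    thus ?case using op_M_add[OF g] pow[OF that(1)] pow[OF that(2)] by (simp add: M_def)
  qed simp
  have eig: "(M ^^ k) \<psi> \<doteq> (\<lambda>x. lam ^ k * \<psi> x)" for k
  proof (induction k)
    case (Suc k)
    have "M ((M ^^ k) \<psi>) \<doteq> M (\<lambda>x. lam ^ k * \<psi> x)"
      unfolding M_def using pow[OF \<psi>(1)] Suc \<psi>(1) by (intro op_M_cong[OF g]) (auto simp: M_def)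
    hence "AE x in I\<pi>. M ((M ^^ k) \<psi>) x = lam ^ k * M \<psi> x"
      by (simp add: L2_eq_def M_def op_M_cmult)
    moreover have "AE x in I\<pi>. M \<psi> x = lam * \<psi> x" using \<psi>(2) by (simp add: L2_eq_def M_def)
    ultimately show ?case unfolding L2_eq_def by eventually_elim simp
  qed (simp add: L2_eq_def)
  define d where "d = (\<lambda>x. \<Pi>proj n \<psi> x - \<psi> x)"
  have d: "d \<in> L2" unfolding d_def using \<psi>(1) by (intro L2_diff) auto
  have d_norm: "L2_norm d = L2_norm (\<lambda>x. \<psi> x - \<Pi>proj n \<psi> x)"
    unfolding d_def by (rule L2_norm_minus_commute)
  have "\<Pi>proj n \<psi> = (\<lambda>x. \<psi> x + d x)" by (simp add: d_def)
  hence "\<Pi>proj n ((M ^^ k) (\<Pi>proj n \<psi>)) = (\<lambda>x. \<Pi>proj n ((M ^^ k) \<psi>) x + \<Pi>proj n ((M ^^ k) d) x)"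
    using pow[OF \<psi>(1)] pow[OF d] by (simp add: add[OF \<psi>(1) d] \<Pi>proj_add)
  also have "\<Pi>proj n ((M ^^ k) \<psi>) = (\<lambda>x. lam ^ k * \<Pi>proj n \<psi> x)"
    using \<Pi>proj_cong[OF eig[of k]] pow[OF \<psi>(1)] \<psi>(1) by (simp add: L2_cmult \<Pi>proj_cmult)
  finally have "(\<lambda>x. \<Pi>proj n ((M ^^ k) (\<Pi>proj n \<psi>)) x - lam ^ k * \<psi> x) =
      (\<lambda>x. \<Pi>proj n ((M ^^ k) d) x + lam ^ k * d x)"
    by (simp add: d_def algebra_simps)
  hence "L2_norm (\<lambda>x. \<Pi>proj n ((M ^^ k) (\<Pi>proj n \<psi>)) x - lam ^ k * \<psi> x) \<le>
      L2_norm (\<Pi>proj n ((M ^^ k) d)) + L2_norm (\<lambda>x. lam ^ k * d x)"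
    using pow[OF d] d by (simp add: L2_norm_triangle L2_cmult)
  also have "L2_norm (\<Pi>proj n ((M ^^ k) d)) \<le> C ^ k * L2_norm d"
    using \<Pi>proj_contraction[of "(M ^^ k) d" n] pow[OF d, of k] by linarith
  finally show ?thesis
    by (simp add: L2_norm_cmult norm_power d_norm ring_distribs M_def)
qed

text \<open>
  Dividing the eigenvalue equation by \<open>lam - s\<close> expands \<open>\<psi>\<close> in the functions \<open>g\<^sub>j / (lam - s)\<close>. These
  are only assumed integrable, so the coefficients are computed with integrals rather than with
  the linearity of the inner product on \<open>L2\<close>.
\<close>

lemma eigenfunction_fourier_coeff:
  assumes g: "\<forall>j\<in>{1..l}. g j \<in> L2"
    and ne: "AE x in I\<pi>. lam \<noteq> complex_of_real (s x)"
    and h: "\<forall>j\<in>{1..l}. integrable I\<pi> (\<lambda>x. g j x / (lam - complex_of_real (s x)))"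
    and \<psi>: "\<psi> \<in> L2" "op_M s l g \<psi> \<doteq> (\<lambda>x. lam * \<psi> x)"
  shows "fourier_coeff \<psi> k =
    (\<Sum>j=1..l. L2_inner \<psi> (g j) * fourier_coeff (\<lambda>x. g j x / (lam - complex_of_real (s x))) k)"
proof -
  define H where "H = (\<lambda>j x. g j x / (lam - complex_of_real (s x)))"
  have int: "integrable I\<pi> (\<lambda>x. H j x * cnj (fourier_mode k x))" if "j \<in> {1..l}" for j
  proof (rule Bochner_Integration.integrable_bound)
    show "integrable I\<pi> (H j)" using h that by (simp add: H_def)
    thus "(\<lambda>x. H j x * cnj (fourier_mode k x)) \<in> borel_measurable I\<pi>"
      using fourier_mode_measurable[of "-k"] by (auto simp: cnj_fourier_mode)
  qed (simp add: norm_mult)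
  have "AE x in I\<pi>. op_M s l g \<psi> x = lam * \<psi> x" using \<psi>(2) by (simp add: L2_eq_def)
  with ne have rep: "AE x in I\<pi>. \<psi> x = (\<Sum>j=1..l. L2_inner \<psi> (g j) * H j x)"
  proof eventually_elim
    case (elim x)
    have "(\<Sum>j=1..l. L2_inner \<psi> (g j) * g j x) = (lam - complex_of_real (s x)) * \<psi> x"
      using elim(2) by (simp add: op_M_def op_S_def op_K_def algebra_simps)
    hence "\<psi> x = (\<Sum>j=1..l. L2_inner \<psi> (g j) * g j x) / (lam - complex_of_real (s x))"
      using elim(1) by simp
    thus ?case by (simp add: H_def sum_divide_distrib)
  qed
  have "(LINT x|I\<pi>. \<psi> x * cnj (fourier_mode k x)) =
      (LINT x|I\<pi>. (\<Sum>j=1..l. L2_inner \<psi> (g j) * (H j x * cnj (fourier_mode k x))))"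
  proof (rule integral_cong_AE)
    show "(\<lambda>x. \<psi> x * cnj (fourier_mode k x)) \<in> borel_measurable I\<pi>"
      using L2_integrable_mult_cnj[OF \<psi>(1) fourier_mode_L2] by simp
    show "(\<lambda>x. \<Sum>j=1..l. L2_inner \<psi> (g j) * (H j x * cnj (fourier_mode k x))) \<in> borel_measurable I\<pi>"
      using int by (intro borel_measurable_integrable Bochner_Integration.integrable_sum integrable_mult_right) auto
    show "AE x in I\<pi>. \<psi> x * cnj (fourier_mode k x) =
        (\<Sum>j=1..l. L2_inner \<psi> (g j) * (H j x * cnj (fourier_mode k x)))"
      using rep by eventually_elim (simp add: sum_distrib_right mult.assoc)
  qed
  also have "\<dots> = (\<Sum>j=1..l. L2_inner \<psi> (g j) * (LINT x|I\<pi>. H j x * cnj (fourier_mode k x)))"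
    using int by (subst Bochner_Integration.integral_sum) auto
  finally show ?thesis
    by (simp add: fourier_coeff_def L2_inner_def H_def sum_distrib_left mult_ac)
qed

theorem lemma3:
  fixes s :: "real \<Rightarrow> real"
    and l :: nat
    and g :: "nat \<Rightarrow> real \<Rightarrow> complex"
    and lam :: complex
    and q :: real
  assumes "s \<in> borel_measurable I\<pi>"
    and "bounded (s ` {-pi<..<pi})"
    and "\<forall>j\<in>{1..l}. g j \<in> L2"
    and "lam \<in> Spec_disc (op_M s l g)"
    and "q \<ge> 1"
    and "\<forall>j\<in>{1..l}. periodic_ext (\<lambda>x. g j x / (lam - complex_of_real (s x))) \<in> \<O>_class q"
  shows "\<exists>\<delta> :: nat \<Rightarrow> real.
      (\<forall>n. \<delta> n > 0) \<and>
      \<delta> \<in> O(\<lambda>n. real n powr (- q + 1 / 2)) \<and>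
      (\<forall>\<psi>\<in>L2. op_M s l g \<psi> \<doteq> (\<lambda>x. lam * \<psi> x) \<longrightarrow> L2_norm \<psi> = 1 \<longrightarrow>
        (\<forall>n. \<forall>k\<in>{0, 1, 2}.
           L2_norm (\<lambda>x. \<Pi>proj n ((op_M s l g ^^ k) (\<Pi>proj n \<psi>)) x - lam ^ k * \<psi> x) \<le> \<delta> n))"
proof -
  define h where "h = (\<lambda>j x. g j x / (lam - complex_of_real (s x)))"
  have ne: "AE x in I\<pi>. lam \<noteq> complex_of_real (s x)"
    using assms by (intro finite_multiplicity_imp_AE_ne[OF assms(1,3)]) (simp add: Spec_disc_def)
  have h: "periodic_ext (h j) \<in> \<O>_class q" if "j \<in> {1..l}" for j
    using assms(6) that by (simp add: h_def)
  hence h_int: "\<forall>j\<in>{1..l}. integrable I\<pi> (h j)"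
    by (auto simp: \<O>_class_def integrable_periodic_ext_iff)
  have "\<forall>j\<in>{1..l}. \<exists>c N. c \<ge> 0 \<and>
      (\<forall>k. \<bar>k\<bar> \<ge> int N \<longrightarrow> cmod (fourier_coeff (h j) k) \<le> c * \<bar>real_of_int k\<bar> powr (- q))"
    using \<O>_class_decay[OF h] by (metis fourier_coeff_periodic_ext)
  then obtain c N where c: "\<And>j. j \<in> {1..l} \<Longrightarrow> c j \<ge> 0"
    and decay: "\<And>j k. j \<in> {1..l} \<Longrightarrow> \<bar>k\<bar> \<ge> int (N j) \<Longrightarrow>
      cmod (fourier_coeff (h j) k) \<le> c j * \<bar>real_of_int k\<bar> powr (- q)"
    by metis
  (* The summand 1 keeps D positive even if l = 0 or all g j vanish: the bound has to be strictly
     positive. The summand 1 in N0 excludes n = 0 from the power law, as 0 powr a = 0. *)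
  define D where "D = (\<Sum>j=1..l. L2_norm (g j) * c j) + 1"
  define N0 where "N0 = (\<Sum>j=1..l. N j) + 1"
  have D: "D > 0" unfolding D_def using c by (intro add_nonneg_pos sum_nonneg) auto
  have N0: "N j \<le> N0" if "j \<in> {1..l}" for j
    using member_le_sum[OF that, of N] by (simp add: N0_def)
  obtain C where C: "C \<ge> 0" "\<And>f. f \<in> L2 \<Longrightarrow> op_M s l g f \<in> L2"
    "\<And>f. f \<in> L2 \<Longrightarrow> L2_norm (op_M s l g f) \<le> C * L2_norm f"
    using op_M_bounded[OF assms(1,2,3)] by blast
  define A where "A = (\<Sum>k\<in>{0,1,2::nat}. C ^ k + cmod lam ^ k)"
  have A_ge: "C ^ k + cmod lam ^ k \<le> A" if "k \<in> {0,1,2}" for k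
    unfolding A_def using that C(1) by (intro member_le_sum) auto
  have A: "A > 0" using A_ge[of 0] by simp
  (* Below N0 the coefficients are not controlled, and the trivial bound by the norm of the
     eigenfunction is used; finitely many n do not affect the rate. *)
  define \<epsilon> where "\<epsilon> = (\<lambda>n. if n < N0 then 1 else 2 * D * real n powr (- q + 1 / 2))"
  have \<epsilon>: "\<epsilon> n > 0" for n using D by (auto simp: \<epsilon>_def N0_def)
  have err: "L2_norm (\<lambda>x. \<psi> x - \<Pi>proj n \<psi> x) \<le> \<epsilon> n"
    if \<psi>: "\<psi> \<in> L2" "op_M s l g \<psi> \<doteq> (\<lambda>x. lam * \<psi> x)" "L2_norm \<psi> = 1" for \<psi> n
  proof (cases "n < N0")
    case True
    thus ?thesis using L2_norm_diff_\<Pi>proj_le[OF \<psi>(1)] \<psi>(3) by (simp add: \<epsilon>_def)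
  next
    case False
    have "cmod (fourier_coeff \<psi> k) \<le> D * \<bar>real_of_int k\<bar> powr (- q)" if k: "\<bar>k\<bar> \<ge> int n" for k
    proof -
      have "cmod (fourier_coeff \<psi> k) \<le> (\<Sum>j=1..l. cmod (L2_inner \<psi> (g j)) * cmod (fourier_coeff (h j) k))"
        unfolding eigenfunction_fourier_coeff[OF assms(3) ne h_int[unfolded h_def] \<psi>(1,2)] h_def[symmetric]
        by (rule order_trans[OF norm_sum]) (simp add: norm_mult h_def)
      also have "\<dots> \<le> (\<Sum>j=1..l. L2_norm (g j) * (c j * \<bar>real_of_int k\<bar> powr (- q)))"
      proof (intro sum_mono mult_mono)
        fix j assume j: "j \<in> {1..l}"
        show "cmod (L2_inner \<psi> (g j)) \<le> L2_norm (g j)"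
          using L2_Cauchy_Schwarz[OF \<psi>(1), of "g j"] assms(3) j \<psi>(3) by simp
        show "cmod (fourier_coeff (h j) k) \<le> c j * \<bar>real_of_int k\<bar> powr (- q)"
          using N0[OF j] False k by (intro decay j) linarith
      qed auto
      also have "\<dots> = (D - 1) * \<bar>real_of_int k\<bar> powr (- q)"
        by (simp add: D_def sum_distrib_right mult.assoc)
      also have "\<dots> \<le> D * \<bar>real_of_int k\<bar> powr (- q)" by (intro mult_right_mono) auto
      finally show ?thesis .
    qed
    hence "L2_norm (\<lambda>x. \<psi> x - \<Pi>proj n \<psi> x) \<le> 2 * D * real n powr (- q + 1 / 2)"
      using D False by (intro \<Pi>proj_error_of_fourier_decay \<psi> assms) (auto simp: N0_def)
    thus ?thesis using False by (simp add: \<epsilon>_def)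
  qed
  show ?thesis
  proof (intro exI[of _ "\<lambda>n. A * \<epsilon> n"] conjI allI ballI impI)
    show "A * \<epsilon> n > 0" for n using A \<epsilon> by simp
    show "(\<lambda>n. A * \<epsilon> n) \<in> O(\<lambda>n. real n powr (- q + 1 / 2))"
    proof (rule bigoI)
      show "eventually (\<lambda>n. norm (A * \<epsilon> n) \<le> (A * (2 * D)) * norm (real n powr (- q + 1 / 2))) sequentially"
        using eventually_ge_at_top[of N0] by eventually_elim (use A D in \<open>simp add: \<epsilon>_def abs_mult\<close>)
    qed
    fix \<psi> n and k :: nat
    assume \<psi>: "\<psi> \<in> L2" "op_M s l g \<psi> \<doteq> (\<lambda>x. lam * \<psi> x)" "L2_norm \<psi> = 1" and k: "k \<in> {0, 1, 2}"
    have "L2_norm (\<lambda>x. \<Pi>proj n ((op_M s l g ^^ k) (\<Pi>proj n \<psi>)) x - lam ^ k * \<psi> x) \<le>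
        (C ^ k + cmod lam ^ k) * L2_norm (\<lambda>x. \<psi> x - \<Pi>proj n \<psi> x)"
      by (rule compression_error[OF assms(1,3) C \<psi>(1,2)])
    also have "\<dots> \<le> A * \<epsilon> n"
      using A by (intro mult_mono A_ge k err \<psi>) auto
    finally show "L2_norm (\<lambda>x. \<Pi>proj n ((op_M s l g ^^ k) (\<Pi>proj n \<psi>)) x - lam ^ k * \<psi> x) \<le> A * \<epsilon> n" .
  qed
qed

end
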